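(* Let $1\le s\in\mathbb{R}$ and let $H^s(\mathbb{R}^N)$ be equipped with the norm $$|||u|||_{H^s(\mathbb{R}^N)}=\Big(\int_{\mathbb{R}^N}\big(1+(2\pi|\xi|)^{2s}\big)|(\mathcal{F}u)(\xi)|^2\,d\xi\Big)^{1/2}$$ and corresponding inner product $\langle u,v\rangle_{H^s(\mathbb{R}^N)}=\int_{\mathbb{R}^N}\big(1+(2\pi|\xi|)^{2s}\big)(\mathcal{F}u)(\xi)\overline{(\mathcal{F}v)(\xi)}\,d\xi$. Then for each $u\in L_2(\mathbb{R}^N)$ the element $E_s^*u$ is given by $$(E_s^*u)(x)=\mathcal{F}^{-1}\Big(\big(1+(2\pi|\cdot|)^{2s}\big)^{-1}\mathcal{F}u\Big)(x).$$
   Context: $N\in\mathbb{N}$; $L_2(\mathbb{R}^N)$ is the complex Lebesgue space with $\langle u,v\rangle_{L_2(\mathbb{R}^N)}=\int u\overline v\,dx$. The Fourier transform is $(\mathcal{F}u)(\xi)=\int_{\mathbb{R}^N}e^{-2\pi i\xi\cdot x}u(x)\,dx$ and $(\mathcal{F}^{-1}u)(x)=\int_{\mathbb{R}^N}e^{2\pi ix\cdot\xi}u(\xi)\,d\xi$, extended to bounded, mutually inverse operators on $L_2(\mathbb{R}^N)$. $H^s(\mathbb{R}^N)$ is the set of $u\in L_2(\mathbb{R}^N)$ with $\mathcal{F}^{-1}\big((1+4\pi^2|\cdot|^2)^{s/2}\mathcal{F}u\big)\in L_2(\mathbb{R}^N)$. $E_s:H^s(\mathbb{R}^N)\to L_2(\mathbb{R}^N)$,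 $E_su:=u$, is the embedding operator, and its adjoint $E_s^*:L_2(\mathbb{R}^N)\to H^s(\mathbb{R}^N)$ is defined by $\langle E_s^*u,v\rangle_{H^s(\mathbb{R}^N)}=\langle u,v\rangle_{L_2(\mathbb{R}^N)}$ for all $u\in L_2(\mathbb{R}^N)$, $v\in H^s(\mathbb{R}^N)$ (with the inner product of the claim). *)

theory Defs
  imports "HOL-Analysis.Analysis"
begin

text \<open>
  Elements of \<open>L\<^sub>2(\<real>\<^sup>N)\<close> are represented by Lebesgue measurable functions
  \<open>real ^ 'n \<Rightarrow> complex\<close>, with \<open>N = CARD('n)\<close>; equality in \<open>L\<^sub>2\<close> is equality
  almost everywhere.
\<close>

definition L2 :: "(real ^ 'n \<Rightarrow> complex) set" where
  "L2 = {u \<in> borel_measurable lebesgue. integrable lebesgue (\<lambda>x. (cmod (u x))\<^sup>2)}"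

definition L2_inner :: "(real ^ 'n \<Rightarrow> complex) \<Rightarrow> (real ^ 'n \<Rightarrow> complex) \<Rightarrow> complex" where
  "L2_inner u v = (LINT x|lebesgue. u x * cnj (v x))"

definition L2_norm :: "(real ^ 'n \<Rightarrow> complex) \<Rightarrow> real" where
  "L2_norm u = sqrt (LINT x|lebesgue. (cmod (u x))\<^sup>2)"

definition fourier_integral :: "(real ^ 'n \<Rightarrow> complex) \<Rightarrow> real ^ 'n \<Rightarrow> complex" where
  "fourier_integral u \<xi> =
     (LINT x|lebesgue. exp (- 2 * complex_of_real pi * \<i> * complex_of_real (\<xi> \<bullet> x)) * u x)"

definition inv_fourier_integral :: "(real ^ 'n \<Rightarrow> complex) \<Rightarrow> real ^ 'n \<Rightarrow> complex" where
  "inv_fourier_integral u x =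
     (LINT \<xi>|lebesgue. exp (2 * complex_of_real pi * \<i> * complex_of_real (x \<bullet> \<xi>)) * u \<xi>)"

text \<open>
  Extension by continuity to \<open>L\<^sub>2\<close> of an operator \<open>T\<close> given on \<open>L\<^sub>1 \<inter> L\<^sub>2\<close>: \<open>g\<close> is the
  value at \<open>u\<close> if \<open>(u, g)\<close> is an \<open>L\<^sub>2\<close>-limit of pairs \<open>(U n, T (U n))\<close> with
  \<open>U n \<in> L\<^sub>1 \<inter> L\<^sub>2\<close>. For the two Fourier integrals such a \<open>g\<close> exists for every \<open>u \<in> L\<^sub>2\<close>
  and is unique up to null sets (Plancherel), so that the choice in \<open>L2_extension\<close> only
  selects a representative.
\<close>

definition L2_extends_to ::
  "((real ^ 'n \<Rightarrow> complex) \<Rightarrow> real ^ 'n \<Rightarrow> complex)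
    \<Rightarrow> (real ^ 'n \<Rightarrow> complex) \<Rightarrow> (real ^ 'n \<Rightarrow> complex) \<Rightarrow> bool" where
  "L2_extends_to T u g \<longleftrightarrow> u \<in> L2 \<and> g \<in> L2 \<and>
     (\<exists>U. (\<forall>n::nat. integrable lebesgue (U n) \<and> U n \<in> L2 \<and> T (U n) \<in> L2) \<and>
          (\<lambda>n. L2_norm (\<lambda>x. U n x - u x)) \<longlonglongrightarrow> 0 \<and>
          (\<lambda>n. L2_norm (\<lambda>\<xi>. T (U n) \<xi> - g \<xi>)) \<longlonglongrightarrow> 0)"

definition L2_extension ::
  "((real ^ 'n \<Rightarrow> complex) \<Rightarrow> real ^ 'n \<Rightarrow> complex)
    \<Rightarrow> (real ^ 'n \<Rightarrow> complex) \<Rightarrow> real ^ 'n \<Rightarrow> complex" where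
  "L2_extension T u = (SOME g. L2_extends_to T u g)"

definition fourier :: "(real ^ 'n \<Rightarrow> complex) \<Rightarrow> real ^ 'n \<Rightarrow> complex" where
  "fourier = L2_extension fourier_integral"

definition inv_fourier :: "(real ^ 'n \<Rightarrow> complex) \<Rightarrow> real ^ 'n \<Rightarrow> complex" where
  "inv_fourier = L2_extension inv_fourier_integral"

text \<open>
  The first membership below says that the argument lies in the domain of the operator
  \<open>inv_fourier\<close> on \<open>L2\<close>; outside this domain the total function \<open>inv_fourier\<close> has an
  arbitrary value.
\<close>

definition sobolev :: "real \<Rightarrow> (real ^ 'n \<Rightarrow> complex) set" where
  "sobolev s = {u \<in> L2.
     (\<lambda>\<xi>. complex_of_real ((1 + 4 * pi\<^sup>2 * (norm \<xi>)\<^sup>2) powr (s / 2)) * fourier u \<xi>) \<in> L2 \<and>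
     inv_fourier (\<lambda>\<xi>. complex_of_real ((1 + 4 * pi\<^sup>2 * (norm \<xi>)\<^sup>2) powr (s / 2)) * fourier u \<xi>)
       \<in> L2}"

definition sobolev_weight :: "real \<Rightarrow> real ^ 'n \<Rightarrow> real" where
  "sobolev_weight s \<xi> = 1 + (2 * pi * norm \<xi>) powr (2 * s)"

definition sobolev_norm :: "real \<Rightarrow> (real ^ 'n \<Rightarrow> complex) \<Rightarrow> real" where
  "sobolev_norm s u = sqrt (LINT \<xi>|lebesgue. sobolev_weight s \<xi> * (cmod (fourier u \<xi>))\<^sup>2)"

definition sobolev_inner ::
  "real \<Rightarrow> (real ^ 'n \<Rightarrow> complex) \<Rightarrow> (real ^ 'n \<Rightarrow> complex) \<Rightarrow> complex" where
  "sobolev_inner s u v =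
     (LINT \<xi>|lebesgue. complex_of_real (sobolev_weight s \<xi>) * fourier u \<xi> * cnj (fourier v \<xi>))"

lemma sobolev_inner_self: "sobolev_inner s u u = complex_of_real ((sobolev_norm s u)\<^sup>2)"
proof -
  have nonneg: "0 \<le> (LINT \<xi>|lebesgue. sobolev_weight s \<xi> * (cmod (fourier u \<xi>))\<^sup>2)"
    by (rule integral_nonneg_AE) (simp add: sobolev_weight_def add_nonneg_nonneg)
  have "complex_of_real (sobolev_weight s \<xi>) * fourier u \<xi> * cnj (fourier u \<xi>) =
      complex_of_real (sobolev_weight s \<xi> * (cmod (fourier u \<xi>))\<^sup>2)" for \<xi>
    by (simp add: complex_norm_square mult.assoc del: of_real_power)
  then show ?thesis
    using nonneg by (simp add: sobolev_inner_def sobolev_norm_def del: of_real_mult of_real_power)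
qed

text \<open>
  \<open>w\<close> represents \<open>E\<^sub>s\<^sup>* u\<close>, where \<open>E\<^sub>s\<close> is the embedding of \<open>sobolev s\<close> into \<open>L2\<close>, i.e. the
  identity on representatives.
\<close>

definition is_embedding_adjoint ::
  "real \<Rightarrow> (real ^ 'n \<Rightarrow> complex) \<Rightarrow> (real ^ 'n \<Rightarrow> complex) \<Rightarrow> bool" where
  "is_embedding_adjoint s u w \<longleftrightarrow>
     w \<in> sobolev s \<and> (\<forall>v \<in> sobolev s. sobolev_inner s w v = L2_inner u v)"

definition embedding_adjoint :: "real \<Rightarrow> (real ^ 'n \<Rightarrow> complex) \<Rightarrow> real ^ 'n \<Rightarrow> complex" where
  "embedding_adjoint s u = (SOME w. is_embedding_adjoint s u w)"

end

theory Submission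
  imports Defs "HOL-Probability.Characteristic_Functions"
begin

text \<open>
  On the Fourier side the claim is immediate: if \<open>F w\<close> is \<open>F u\<close> divided by the weight of the
  Sobolev inner product, then the inner product of \<open>w\<close> and \<open>v\<close> is \<open>\<integral> F u * cnj (F v)\<close>, which is
  the inner product of \<open>u\<close> and \<open>v\<close> in \<open>L2\<close> by Plancherel's identity
  (\<open>is_embedding_adjoint_inv_fourier\<close>). Since the Sobolev inner product is definite, the adjoint
  is determined up to null sets (\<open>embedding_adjoint_unique\<close>), so every choice of a representative
  agrees with this \<open>w\<close> almost everywhere.

  Most of the work is the Fourier transform on \<open>L2\<close> in several dimensions. Inserting a Gaussian
  cutoff and applying Fubini writes \<open>\<integral> |F U|\<^sup>2\<close> as a limit of averages of the correlation of \<open>U\<close>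
  with itself against a heat kernel. This gives \<open>\<parallel>F U\<parallel> \<le> \<parallel>U\<parallel>\<close> for every integrable \<open>U\<close> in \<open>L2\<close>
  (\<open>osc_integral_bessel\<close>), with no continuity of translations needed, and equality for indicator functions
  of open sets of finite measure by Fatou's lemma (\<open>osc_integral_indicator_open_ge\<close>). The bound, together with completeness,
  yields the extension to \<open>L2\<close>, its uniqueness, and the fact that the two Fourier transforms are
  adjoint contractions (\<open>L2_extends_exists\<close>, \<open>L2_extends_unique\<close>, \<open>L2_extends_adjoint\<close>). For adjoint contractions
  isometry on a vector \<open>u\<close> forces \<open>F' F u = u\<close> (\<open>L2_extends_inverse_of_isometric\<close>). This applies to
  indicator functions of open sets, then by regularity to those of all measurable sets of finite
  measure, and by self-adjointness of \<open>F' F\<close> it extends to all of \<open>L2\<close> (\<open>L2_extends_inverse\<close>), whence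
  Plancherel's identity.
\<close>

section \<open>Gaussians in several dimensions\<close>

text \<open>
  The density of the standard normal distribution on a Euclidean space, as a product over the
  coordinates, so that its integrals factor by Fubini.
\<close>

definition gauss :: "'a::euclidean_space \<Rightarrow> real" where
  "gauss z = (\<Prod>b\<in>Basis. std_normal_density (z \<bullet> b))"

lemma gauss_measurable [measurable]: "gauss \<in> borel_measurable borel"
  unfolding gauss_def by measurable

lemma gauss_nonneg [simp]: "0 \<le> gauss z"
  unfolding gauss_def by (intro prod_nonneg) auto

lemma sum_Basis_half_square:
  "(\<Sum>b\<in>Basis. - (z \<bullet> b)\<^sup>2 / 2) = - (norm (z::'a::euclidean_space))\<^sup>2 / 2"
  unfolding power2_norm_eq_inner euclidean_inner[of z z]
  by (simp add: power2_eq_square sum_negf sum_divide_distrib[symmetric])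

lemma gauss_eq: "gauss (z::'a::euclidean_space) =
    (1 / sqrt (2 * pi)) ^ DIM('a) * exp (- (norm z)\<^sup>2 / 2)"
proof -
  have "gauss z = (1 / sqrt (2 * pi)) ^ DIM('a) * (\<Prod>b\<in>Basis. exp (- (z \<bullet> b)\<^sup>2 / 2))"
    unfolding gauss_def std_normal_density_def by (simp add: prod.distrib prod_dividef power_divide)
  also have "(\<Prod>b\<in>Basis. exp (- (z \<bullet> b)\<^sup>2 / 2)) = exp (\<Sum>b\<in>Basis. - (z \<bullet> b)\<^sup>2 / 2)"
    by (simp add: exp_sum)
  also have "(\<Sum>b\<in>Basis. - (z \<bullet> b)\<^sup>2 / 2) = - (norm z)\<^sup>2 / 2"
    by (rule sum_Basis_half_square)
  finally show ?thesis .
qed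

lemma nn_integral_gauss: "(\<integral>\<^sup>+z. ennreal (gauss (z::'a::euclidean_space)) \<partial>lborel) = 1"
proof -
  have "(\<integral>\<^sup>+z. ennreal (gauss (z::'a)) \<partial>lborel) =
      (\<integral>\<^sup>+z. (\<Prod>b\<in>Basis. ennreal (std_normal_density (z \<bullet> b))) \<partial>(lborel :: 'a measure))"
    unfolding gauss_def by (simp add: prod_ennreal)
  also have "\<dots> = (\<Prod>b\<in>(Basis::'a set). \<integral>\<^sup>+x. ennreal (std_normal_density x) \<partial>lborel)"
    by (rule nn_integral_lborel_prod) auto
  also have "(\<integral>\<^sup>+x. ennreal (std_normal_density x) \<partial>lborel) = 1"
    by (subst nn_integral_eq_integral) auto
  finally show ?thesis by simp
qed

text \<open>
  The characteristic function of the standard normal distribution in any dimension: both the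
  integrand and the measure are products over the basis, and in each coordinate the claim is the
  one-dimensional formula.
\<close>

lemma fourier_gauss:
  fixes t :: "'a::euclidean_space"
  shows "(LINT z|lborel. cis (t \<bullet> z) * complex_of_real (gauss z)) =
      complex_of_real (exp (- (norm t)\<^sup>2 / 2))"
proof -
  interpret finite_product_sigma_finite "\<lambda>_. lborel :: real measure" "Basis :: 'a set"
    by standard auto
  let ?f = "\<lambda>(b::'a) (x::real). cis ((t \<bullet> b) * x) * complex_of_real (std_normal_density x)"
  have meas: "?f b \<in> borel_measurable borel" for b
    unfolding cis_conv_exp by measurable
  have int: "integrable lborel (?f b)" for b
    by (rule Bochner_Integration.integrable_bound[OF integrable_normal_density[where \<mu>=0 and \<sigma>=1]])
       (use meas[of b] in \<open>auto simp: norm_mult\<close>)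
  have one: "(LINT x|lborel. ?f b x) = complex_of_real (exp (- (t \<bullet> b)\<^sup>2 / 2))" for b
  proof -
    have "complex_of_real (exp (- (t \<bullet> b)\<^sup>2 / 2)) = char std_normal_distribution (t \<bullet> b)"
      by (simp add: char_std_normal_distribution)
    also have "\<dots> = (LINT x|lborel. std_normal_density x *\<^sub>R iexp ((t \<bullet> b) * x))"
      unfolding char_def by (subst integral_density) auto
    also have "\<dots> = (LINT x|lborel. ?f b x)"
      by (simp add: cis_conv_exp scaleR_conv_of_real mult.commute)
    finally show ?thesis by simp
  qed
  have "(LINT z|lborel. cis (t \<bullet> z) * complex_of_real (gauss z)) =
      (LINT z|lborel. (\<Prod>b\<in>Basis. ?f b (z \<bullet> b)))"
  proof (intro Bochner_Integration.integral_cong refl)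
    fix z :: 'a
    have "cis (t \<bullet> z) = (\<Prod>b\<in>Basis. cis ((t \<bullet> b) * (z \<bullet> b)))"
      unfolding cis_conv_exp by (subst euclidean_inner) (simp add: exp_sum sum_distrib_left)
    then show "cis (t \<bullet> z) * complex_of_real (gauss z) = (\<Prod>b\<in>Basis. ?f b (z \<bullet> b))"
      by (simp add: gauss_def prod.distrib)
  qed
  also have "\<dots> = (LINT g|Pi\<^sub>M Basis (\<lambda>_. lborel). (\<Prod>b\<in>Basis. ?f b (g b)))"
    by (subst lborel_eq, subst integral_distr)
       (auto simp: meas[THEN measurable_compose[rotated]] intro!: Bochner_Integration.integral_cong prod.cong
         borel_measurable_prod measurable_compose[OF _ meas])
  also have "\<dots> = (\<Prod>b\<in>Basis. LINT x|lborel. ?f b x)"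
    by (rule product_integral_prod) (auto simp: int)
  also have "\<dots> = (\<Prod>b\<in>Basis. complex_of_real (exp (- (t \<bullet> b)\<^sup>2 / 2)))"
    by (simp only: one)
  also have "\<dots> = complex_of_real (exp (\<Sum>b\<in>Basis. - (t \<bullet> b)\<^sup>2 / 2))"
    by (simp add: exp_sum)
  also have "(\<Sum>b\<in>Basis. - (t \<bullet> b)\<^sup>2 / 2) = - (norm t)\<^sup>2 / 2"
    by (rule sum_Basis_half_square)
  finally show ?thesis .
qed

lemma nn_integral_lborel_affine:
  fixes f :: "'a::euclidean_space \<Rightarrow> ennreal"
  assumes [measurable]: "f \<in> borel_measurable borel" and c: "c \<noteq> 0"
  shows "(\<integral>\<^sup>+x. f x \<partial>lborel) = ennreal (\<bar>c\<bar> ^ DIM('a)) * (\<integral>\<^sup>+x. f (t + c *\<^sub>R x) \<partial>lborel)"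
  by (subst lborel_affine[OF c, of t])
     (simp add: nn_integral_density nn_integral_distr nn_integral_cmult)

lemma integral_lborel_scale:
  fixes f :: "'a::euclidean_space \<Rightarrow> complex"
  assumes [measurable]: "f \<in> borel_measurable borel" and c: "c \<noteq> 0"
  shows "(LINT x|lborel. f x) = (\<bar>c\<bar> ^ DIM('a)) *\<^sub>R (LINT x|lborel. f (c *\<^sub>R x))"
  by (subst lborel_affine[OF c, of 0])
     (simp add: integral_density integral_distr)

text \<open>
  The Gaussian of total mass one concentrated at the scale \<open>1 / r\<close>; an approximate identity as
  \<open>r\<close> tends to infinity.
\<close>

definition heat :: "real \<Rightarrow> 'a::euclidean_space \<Rightarrow> real" where
  "heat r z = r ^ DIM('a) * gauss (r *\<^sub>R z)"

lemma heat_measurable [measurable]: "heat r \<in> borel_measurable borel"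
  unfolding heat_def by measurable

lemma heat_nonneg: "0 < r \<Longrightarrow> 0 \<le> heat r z"
  unfolding heat_def by simp

lemma nn_integral_heat_mult:
  fixes x :: "'a::euclidean_space"
  assumes [measurable]: "f \<in> borel_measurable borel" and r: "0 < r"
  shows "(\<integral>\<^sup>+y. f y * ennreal (heat r (x - y)) \<partial>lborel) =
    (\<integral>\<^sup>+z. f (x - z /\<^sub>R r) * ennreal (gauss z) \<partial>lborel)"
proof -
  have "(\<integral>\<^sup>+y. f y * ennreal (heat r (x - y)) \<partial>lborel) =
      ennreal ((1 / r) ^ DIM('a)) *
        (\<integral>\<^sup>+z. f (x - z /\<^sub>R r) * (ennreal (r ^ DIM('a)) * ennreal (gauss z)) \<partial>lborel)"
    using r by (subst nn_integral_lborel_affine[where c="- (1 / r)" and t=x])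
      (simp_all add: heat_def divide_inverse ennreal_mult)
  also have "(\<integral>\<^sup>+z. f (x - z /\<^sub>R r) * (ennreal (r ^ DIM('a)) * ennreal (gauss z)) \<partial>lborel) =
      ennreal (r ^ DIM('a)) * (\<integral>\<^sup>+z. f (x - z /\<^sub>R r) * ennreal (gauss z) \<partial>lborel)"
    by (subst nn_integral_cmult[symmetric]) (simp_all add: mult_ac)
  also have "ennreal ((1 / r) ^ DIM('a)) * (ennreal (r ^ DIM('a)) *
      (\<integral>\<^sup>+z. f (x - z /\<^sub>R r) * ennreal (gauss z) \<partial>lborel)) =
      (\<integral>\<^sup>+z. f (x - z /\<^sub>R r) * ennreal (gauss z) \<partial>lborel)"
    using r by (simp add: mult.assoc[symmetric] ennreal_mult[symmetric] power_mult_distrib[symmetric])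
  finally show ?thesis .
qed

lemma nn_integral_heat:
  fixes x :: "'a::euclidean_space"
  assumes "0 < r"
  shows "(\<integral>\<^sup>+y. ennreal (heat r (x - y)) \<partial>lborel) = 1"
  using nn_integral_heat_mult[of "\<lambda>_. 1" r x] assms by (simp add: nn_integral_gauss)

lemma heat_minus: "heat r (x - y) = heat r (y - x)"
  unfolding heat_def gauss_eq by (simp add: norm_minus_commute)

text \<open>
  The Gaussian cutoff on the frequency side. Its Fourier transform, in the normalisation with
  \<open>2 * pi\<close> in the exponent, is \<open>heat r\<close>, and it increases to \<open>1\<close> as \<open>r\<close> tends to infinity.
\<close>

definition gweight :: "real \<Rightarrow> 'a::euclidean_space \<Rightarrow> real" where
  "gweight r \<xi> = exp (- (2 * pi / r * norm \<xi>)\<^sup>2 / 2)"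

lemma gweight_measurable [measurable]: "gweight r \<in> borel_measurable borel"
  unfolding gweight_def by measurable

lemma gweight_bounds: "0 \<le> gweight r \<xi>" "gweight r \<xi> \<le> 1"
  unfolding gweight_def by auto

lemma gweight_gauss:
  fixes \<xi> :: "'a::euclidean_space"
  shows "gweight r \<xi> = sqrt (2 * pi) ^ DIM('a) * gauss ((2 * pi / r) *\<^sub>R \<xi>)"
  unfolding gweight_def gauss_eq by (simp add: power_divide power_mult_distrib power2_eq_square)

lemma integrable_gweight:
  assumes "0 < r"
  shows "integrable lborel (gweight r :: 'a::euclidean_space \<Rightarrow> real)"
proof (rule integrableI_nonneg)
  have "(\<integral>\<^sup>+z. ennreal (gauss (z::'a)) \<partial>lborel) = ennreal (\<bar>2 * pi / r\<bar> ^ DIM('a)) *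
      (\<integral>\<^sup>+z. ennreal (gauss ((2 * pi / r) *\<^sub>R (z::'a))) \<partial>lborel)"
    using assms by (subst nn_integral_lborel_affine[where c="2 * pi / r" and t=0]) auto
  then have "ennreal (\<bar>2 * pi / r\<bar> ^ DIM('a)) *
      (\<integral>\<^sup>+z. ennreal (gauss ((2 * pi / r) *\<^sub>R (z::'a))) \<partial>lborel) = 1"
    by (simp add: nn_integral_gauss)
  then have "(\<integral>\<^sup>+z. ennreal (gauss ((2 * pi / r) *\<^sub>R (z::'a))) \<partial>lborel) < \<infinity>"
    using assms by (auto simp: ennreal_mult_eq_top_iff less_top[symmetric] )
  then show "(\<integral>\<^sup>+z. ennreal (gweight r (z::'a)) \<partial>lborel) < \<infinity>"
    unfolding gweight_gauss
    by (simp add: ennreal_mult nn_integral_cmult ennreal_mult_less_top)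
qed (auto simp: gweight_bounds)

lemma fourier_gweight:
  fixes z :: "'a::euclidean_space"
  assumes r: "0 < r" and c: "\<bar>c\<bar> = 2 * pi"
  shows "(LINT \<xi>|lborel. cis (c * (\<xi> \<bullet> z)) * complex_of_real (gweight r \<xi>)) =
    complex_of_real (heat r z)"
proof -
  \<comment> \<open>the dilation that turns \<open>gweight r\<close> into a multiple of \<open>gauss\<close>\<close>
  define a where "a = r / (2 * pi)"
  have a: "a > 0" using r by (simp add: a_def)
  have [measurable]: "(\<lambda>\<xi>::'a. cis (c * (\<xi> \<bullet> z))) \<in> borel_measurable borel"
    unfolding cis_conv_exp by measurable
  have "(LINT \<xi>|lborel. cis (c * (\<xi> \<bullet> z)) * complex_of_real (gweight r \<xi>)) =
     (\<bar>a\<bar> ^ DIM('a)) *\<^sub>R (LINT \<xi>|lborel. cis (c * ((a *\<^sub>R \<xi>) \<bullet> z)) * complex_of_real (gweight r (a *\<^sub>R \<xi>)))"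
    by (rule integral_lborel_scale) (use a in auto)
  also have "(LINT \<xi>|lborel. cis (c * ((a *\<^sub>R \<xi>) \<bullet> z)) * complex_of_real (gweight r (a *\<^sub>R \<xi>))) =
     (LINT \<xi>|lborel. complex_of_real (sqrt (2 * pi) ^ DIM('a)) *
        (cis (((c * a) *\<^sub>R z) \<bullet> \<xi>) * complex_of_real (gauss \<xi>)))"
    using r by (intro Bochner_Integration.integral_cong refl)
      (simp add: gweight_gauss a_def inner_commute mult_ac)
  also have "\<dots> = complex_of_real (sqrt (2 * pi) ^ DIM('a) * exp (- (norm ((c * a) *\<^sub>R z))\<^sup>2 / 2))"
    by (subst integral_mult_right_zero) (simp only: fourier_gauss of_real_mult)
  also have "norm ((c * a) *\<^sub>R z) = norm (r *\<^sub>R z)"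
    using r by (simp add: abs_mult c a_def)
  also have "\<bar>a\<bar> ^ DIM('a) *\<^sub>R complex_of_real (sqrt (2 * pi) ^ DIM('a) * exp (- (norm (r *\<^sub>R z))\<^sup>2 / 2))
     = complex_of_real (\<bar>a\<bar> ^ DIM('a) * (sqrt (2 * pi) ^ DIM('a) * exp (- (norm (r *\<^sub>R z))\<^sup>2 / 2)))"
    by (simp only: scaleR_conv_of_real of_real_mult)
  also have "\<bar>a\<bar> ^ DIM('a) * (sqrt (2 * pi) ^ DIM('a) * exp (- (norm (r *\<^sub>R z))\<^sup>2 / 2)) = heat r z"
  proof -
    have "\<bar>a\<bar> * sqrt (2 * pi) = r * (1 / sqrt (2 * pi))"
      using r by (simp add: a_def real_div_sqrt field_simps)
    then show ?thesis
      unfolding heat_def gauss_eq mult.assoc[symmetric] power_mult_distrib[symmetric] by simp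
  qed
  finally show ?thesis .
qed

section \<open>Oscillatory integrals and the Gaussian cutoff\<close>

lemma sigma_finite_lebesgue: "sigma_finite_measure (lebesgue :: 'a::euclidean_space measure)"
proof -
  obtain A :: "'a set set" where "countable A" "A \<subseteq> sets lborel" "\<Union>A = space lborel"
      "\<forall>a\<in>A. emeasure lborel a \<noteq> \<infinity>"
    using lborel.sigma_finite_countable by blast
  then show ?thesis
    by (intro sigma_finite_measure.intro exI[of _ A]) (auto simp: subset_iff)
qed

interpretation lebesgue: sigma_finite_measure "lebesgue :: 'a::euclidean_space measure"
  by (rule sigma_finite_lebesgue)

interpretation lebesgue_pair: pair_sigma_finite
  "lebesgue :: 'a::euclidean_space measure" "lebesgue :: 'b::euclidean_space measure" ..

lemma measurable_ident_lebesgue: "(\<lambda>x. x) \<in> lebesgue \<rightarrow>\<^sub>M borel"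
  using measurable_completion[of "\<lambda>x. x" lborel borel] by simp

lemma measurable_fst_lebesgue [measurable]: "fst \<in> lebesgue \<Otimes>\<^sub>M M \<rightarrow>\<^sub>M borel"
  by (rule measurable_compose[OF measurable_fst measurable_ident_lebesgue])

lemma measurable_snd_lebesgue [measurable]: "snd \<in> M \<Otimes>\<^sub>M lebesgue \<rightarrow>\<^sub>M borel"
  by (rule measurable_compose[OF measurable_snd measurable_ident_lebesgue])

lemma borel_measurable_cis [measurable]: "cis \<in> borel_measurable borel"
  by (intro borel_measurable_continuous_onI continuous_on_cis continuous_on_id)

lemma measurable_lebesgue_cis [measurable]:
  "(\<lambda>x. cis (c * (\<xi> \<bullet> x))) \<in> borel_measurable lebesgue"
  by (rule measurable_completion) simp

lemma (in pair_sigma_finite) integrable_times: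
  fixes f :: "'a \<Rightarrow> 'c::{real_normed_field, banach, second_countable_topology}"
  assumes [measurable]: "integrable M1 f" "integrable M2 g"
  shows "integrable (M1 \<Otimes>\<^sub>M M2) (\<lambda>p. f (fst p) * g (snd p))"
  by (rule Fubini_integrable) (use assms in \<open>auto simp: norm_mult\<close>)

text \<open>
  The integral operator with kernel \<open>exp (\<i> * c * (\<xi> \<bullet> x))\<close>. The Fourier integral and its inverse
  are the cases \<open>c = - 2 * pi\<close> and \<open>c = 2 * pi\<close>; treating both signs at once avoids proving
  every fact twice.
\<close>

definition osc_integral :: "real \<Rightarrow> (real ^ 'n \<Rightarrow> complex) \<Rightarrow> real ^ 'n \<Rightarrow> complex" where
  "osc_integral c u \<xi> = (LINT x|lebesgue. cis (c * (\<xi> \<bullet> x)) * u x)"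

lemma fourier_integral_eq_osc_integral: "fourier_integral = osc_integral (- (2 * pi))"
  by (intro ext) (simp add: fourier_integral_def osc_integral_def cis_conv_exp mult_ac)

lemma inv_fourier_integral_eq_osc_integral: "inv_fourier_integral = osc_integral (2 * pi)"
  by (intro ext) (simp add: inv_fourier_integral_def osc_integral_def cis_conv_exp mult_ac)

lemma osc_integral_measurable [measurable]:
  assumes [measurable]: "u \<in> borel_measurable lebesgue"
  shows "osc_integral c u \<in> borel_measurable borel"
  unfolding osc_integral_def by measurable

lemma integrable_cis_mult:
  assumes [measurable]: "integrable lebesgue u"
  shows "integrable lebesgue (\<lambda>x. cis (c * (\<xi> \<bullet> x)) * u x)"
  by (rule Bochner_Integration.integrable_bound[OF assms]) (auto simp: norm_mult)

text \<open>
  The cutoff makes the double integral hidden in \<open>(cmod (osc_integral c U \<xi>))\<^sup>2\<close> absolutely convergent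
  jointly with the integral over \<open>\<xi>\<close>. Carrying out the latter first leaves the correlation of
  \<open>U\<close> with itself, averaged against \<open>heat r\<close>.
\<close>

lemma
  fixes U :: "real ^ 'n \<Rightarrow> complex"
  assumes r: "0 < r" and c: "\<bar>c\<bar> = 2 * pi" and U: "integrable lebesgue U"
  defines "V \<equiv> \<lambda>p. U (fst p) * cnj (U (snd p))"
  shows integrable_heat_correlation:
      "integrable (lebesgue \<Otimes>\<^sub>M lebesgue) (\<lambda>p. V p * complex_of_real (heat r (fst p - snd p)))"
    and integral_gweight_osc_integral:
      "(LINT \<xi>|lborel. complex_of_real ((cmod (osc_integral c U \<xi>))\<^sup>2 * gweight r \<xi>)) =
       (LINT p|(lebesgue \<Otimes>\<^sub>M lebesgue). V p * complex_of_real (heat r (fst p - snd p)))"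
    and integrable_gweight_osc_integral:
      "integrable lborel (\<lambda>\<xi>. complex_of_real ((cmod (osc_integral c U \<xi>))\<^sup>2 * gweight r \<xi>))"
proof -
  let ?L = "lebesgue :: (real ^ 'n) measure"
  note [measurable] = borel_measurable_integrable[OF U]
  have V: "integrable (?L \<Otimes>\<^sub>M ?L) V"
    unfolding V_def by (rule lebesgue_pair.integrable_times) (use U in auto)
  have [measurable]: "V \<in> borel_measurable (?L \<Otimes>\<^sub>M ?L)"
    using V by simp
  interpret P: sigma_finite_measure "?L \<Otimes>\<^sub>M ?L"
    by (rule lebesgue_pair.sigma_finite_measure_axioms)
  interpret Q: pair_sigma_finite "lborel :: (real ^ 'n) measure" "?L \<Otimes>\<^sub>M ?L" ..
  define F where "F = (\<lambda>(\<xi>::real ^ 'n) p.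
      complex_of_real (gweight r \<xi>) * (cis (c * (\<xi> \<bullet> (fst p - snd p))) * V p))"
  have F_int: "integrable (lborel \<Otimes>\<^sub>M (?L \<Otimes>\<^sub>M ?L)) (case_prod F)"
  proof (rule Bochner_Integration.integrable_bound)
    show "integrable ((lborel :: (real ^ 'n) measure) \<Otimes>\<^sub>M (?L \<Otimes>\<^sub>M ?L))
        (\<lambda>q. complex_of_real (gweight r (fst q)) * V (snd q))"
    proof -
      have g: "integrable (lborel :: (real ^ 'n) measure) (\<lambda>\<xi>. complex_of_real (gweight r \<xi>))"
        by (intro integrable_of_real integrable_gweight r)
      show ?thesis
        using Q.integrable_times[OF g V] .
    qed
    show "case_prod F \<in> borel_measurable (lborel \<Otimes>\<^sub>M (?L \<Otimes>\<^sub>M ?L))"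
      unfolding F_def by measurable
    show "AE q in lborel \<Otimes>\<^sub>M (?L \<Otimes>\<^sub>M ?L).
        norm (case_prod F q) \<le> norm (complex_of_real (gweight r (fst q)) * V (snd q))"
      by (auto simp: F_def norm_mult split: prod.splits)
  qed
  have inner1: "(LINT \<xi>|lborel. F \<xi> p) = V p * complex_of_real (heat r (fst p - snd p))" for p
  proof -
    have "(LINT \<xi>|lborel. F \<xi> p) =
        (LINT \<xi>|lborel. V p * (cis (c * (\<xi> \<bullet> (fst p - snd p))) * complex_of_real (gweight r \<xi>)))"
      by (simp add: F_def mult_ac)
    then show ?thesis
      by (simp add: fourier_gweight[OF r c])
  qed
  have inner2: "(LINT p|(?L \<Otimes>\<^sub>M ?L). F \<xi> p) = complex_of_real ((cmod (osc_integral c U \<xi>))\<^sup>2 * gweight r \<xi>)" for \<xi>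
  proof -
    define u where "u = (\<lambda>x. cis (c * (\<xi> \<bullet> x)) * U x)"
    have u: "integrable lebesgue u"
      unfolding u_def by (rule integrable_cis_mult[OF U])
    have split: "cis (c * (\<xi> \<bullet> (x - y))) = cis (c * (\<xi> \<bullet> x)) * cnj (cis (c * (\<xi> \<bullet> y)))" for x y
      by (simp add: cis_cnj cis_mult inner_diff_right right_diff_distrib)
    have uu: "integrable (?L \<Otimes>\<^sub>M ?L) (\<lambda>p. u (fst p) * cnj (u (snd p)))"
      by (rule lebesgue_pair.integrable_times) (use u in auto)
    have "(LINT p|(?L \<Otimes>\<^sub>M ?L). F \<xi> p) =
        (LINT p|(?L \<Otimes>\<^sub>M ?L). complex_of_real (gweight r \<xi>) * (u (fst p) * cnj (u (snd p))))"
      by (simp add: F_def V_def u_def split mult_ac)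
    also have "\<dots> = complex_of_real (gweight r \<xi>) * (LINT p|(?L \<Otimes>\<^sub>M ?L). u (fst p) * cnj (u (snd p)))"
      by simp
    also have "(LINT p|(?L \<Otimes>\<^sub>M ?L). u (fst p) * cnj (u (snd p))) = (LINT x|?L. LINT y|?L. u x * cnj (u y))"
      using lebesgue_pair.integral_fst'[OF uu] by simp
    also have "\<dots> = osc_integral c U \<xi> * cnj (osc_integral c U \<xi>)"
      using u by (simp add: osc_integral_def u_def[symmetric] integral_cnj)
    finally show ?thesis
      by (simp add: complex_norm_square mult_ac del: of_real_power)
  qed
  show "integrable (?L \<Otimes>\<^sub>M ?L) (\<lambda>p. V p * complex_of_real (heat r (fst p - snd p)))"
    using Q.integrable_snd[OF F_int] by (simp add: inner1)
  show "integrable lborel (\<lambda>\<xi>. complex_of_real ((cmod (osc_integral c U \<xi>))\<^sup>2 * gweight r \<xi>))"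
    using Q.integrable_fst[OF F_int] by (simp only: inner2)
  show "(LINT \<xi>|lborel. complex_of_real ((cmod (osc_integral c U \<xi>))\<^sup>2 * gweight r \<xi>)) =
       (LINT p|(?L \<Otimes>\<^sub>M ?L). V p * complex_of_real (heat r (fst p - snd p)))"
    using Q.Fubini_integral[OF F_int] by (simp only: inner1 inner2)
qed

lemma measurable_heat_lebesgue [measurable]:
  "(\<lambda>y. heat r (x - y)) \<in> borel_measurable lebesgue"
  "(\<lambda>x. heat r (x - y)) \<in> borel_measurable lebesgue"
  by (rule measurable_completion, simp)+

lemma nn_integral_heat_lebesgue:
  fixes x :: "'a::euclidean_space"
  assumes "0 < r"
  shows "(\<integral>\<^sup>+y. ennreal (heat r (x - y)) \<partial>lebesgue) = 1"
    and "(\<integral>\<^sup>+y. ennreal (heat r (y - x)) \<partial>lebesgue) = 1"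
  using nn_integral_heat[OF assms, of x]
  by (simp_all add: nn_integral_completion heat_minus[of r _ x])

lemma gweight_tendsto: "(\<lambda>n. gweight (real (Suc n)) \<xi>) \<longlonglongrightarrow> 1"
proof -
  have "(\<lambda>n. 2 * pi / real (Suc n)) \<longlonglongrightarrow> 0"
    using tendsto_mult[OF tendsto_const LIMSEQ_inverse_real_of_nat, of "2 * pi"]
    by (simp only: divide_inverse mult_zero_right)
  then have "(\<lambda>n. 2 * pi / real (Suc n) * norm \<xi>) \<longlonglongrightarrow> 0"
    by (rule tendsto_mult_left_zero)
  moreover have "isCont (\<lambda>x::real. exp (- x\<^sup>2 / 2)) 0"
    by (intro continuous_intros) auto
  ultimately have "(\<lambda>n. exp (- (2 * pi / real (Suc n) * norm \<xi>)\<^sup>2 / 2)) \<longlonglongrightarrow> exp (- 0\<^sup>2 / 2)"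
    by (rule isCont_tendsto_compose[rotated])
  then show ?thesis by (simp only: gweight_def) simp
qed

text \<open>
  The averaged correlation is at most the square norm of \<open>U\<close>, because \<open>|a b| \<le> (a\<^sup>2 + b\<^sup>2) / 2\<close> and
  \<open>heat r\<close> has mass one. Fatou's lemma removes the cutoff.
\<close>

lemma osc_integral_bessel:
  fixes U :: "real ^ 'n \<Rightarrow> complex"
  assumes c: "\<bar>c\<bar> = 2 * pi" and U: "integrable lebesgue U"
  shows "(\<integral>\<^sup>+\<xi>. ennreal ((cmod (osc_integral c U \<xi>))\<^sup>2) \<partial>lborel) \<le> (\<integral>\<^sup>+x. ennreal ((cmod (U x))\<^sup>2) \<partial>lebesgue)"
proof -
  let ?L = "lebesgue :: (real ^ 'n) measure"
  let ?N = "\<integral>\<^sup>+x. ennreal ((cmod (U x))\<^sup>2) \<partial>?L"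
  note [measurable] = borel_measurable_integrable[OF U]
  \<comment> \<open>the two halves of the arithmetic-geometric mean bound each contribute half of \<open>?N\<close>\<close>
  have weighted: "(\<integral>\<^sup>+\<xi>. ennreal ((cmod (osc_integral c U \<xi>))\<^sup>2 * gweight r \<xi>) \<partial>lborel) \<le> ?N"
    if r: "0 < r" for r
  proof -
    let ?W = "\<lambda>p. U (fst p) * cnj (U (snd p)) * complex_of_real (heat r (fst p - snd p))"
    have distr: "ennreal ((a + b) * h) = ennreal a * ennreal h + ennreal b * ennreal h"
      if "0 \<le> a" "0 \<le> b" "0 \<le> h" for a b h :: real
      using that by (simp add: distrib_right ennreal_mult)
    have "(\<integral>\<^sup>+\<xi>. ennreal ((cmod (osc_integral c U \<xi>))\<^sup>2 * gweight r \<xi>) \<partial>lborel) =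
        ennreal (LINT \<xi>|lborel. (cmod (osc_integral c U \<xi>))\<^sup>2 * gweight r \<xi>)"
      using integrable_gweight_osc_integral[OF r c U]
      by (intro nn_integral_eq_integral) (auto simp: gweight_bounds complex_of_real_integrable_eq simp del: of_real_mult)
    also have "(LINT \<xi>|lborel. (cmod (osc_integral c U \<xi>))\<^sup>2 * gweight r \<xi>) \<le>
        cmod (LINT \<xi>|lborel. complex_of_real ((cmod (osc_integral c U \<xi>))\<^sup>2 * gweight r \<xi>))"
      by (simp del: of_real_mult)
    also have "\<dots> = cmod (LINT p|(?L \<Otimes>\<^sub>M ?L). ?W p)"
      by (simp only: integral_gweight_osc_integral[OF r c U])
    also have "ennreal (cmod (LINT p|(?L \<Otimes>\<^sub>M ?L). ?W p)) \<le> (\<integral>\<^sup>+p. ennreal (cmod (?W p)) \<partial>(?L \<Otimes>\<^sub>M ?L))"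
      by (rule integral_norm_bound_ennreal[OF integrable_heat_correlation[OF r c U]])
    also have "\<dots> \<le> (\<integral>\<^sup>+p. ennreal ((cmod (U (fst p)))\<^sup>2 / 2) * ennreal (heat r (fst p - snd p)) +
        ennreal ((cmod (U (snd p)))\<^sup>2 / 2) * ennreal (heat r (fst p - snd p)) \<partial>(?L \<Otimes>\<^sub>M ?L))"
    proof (rule nn_integral_mono)
      fix p
      let ?a = "cmod (U (fst p))" and ?b = "cmod (U (snd p))" and ?h = "heat r (fst p - snd p)"
      have h: "0 \<le> ?h" by (rule heat_nonneg[OF r])
      have "?a * ?b \<le> ?a\<^sup>2 / 2 + ?b\<^sup>2 / 2"
        using sum_squares_bound[of ?a ?b] by simp
      then have "?a * ?b * ?h \<le> (?a\<^sup>2 / 2 + ?b\<^sup>2 / 2) * ?h"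
        using h by (rule mult_right_mono)
      then have "ennreal (cmod (?W p)) \<le> ennreal ((?a\<^sup>2 / 2 + ?b\<^sup>2 / 2) * ?h)"
        using h by (simp add: norm_mult)
      also have "\<dots> = ennreal (?a\<^sup>2 / 2) * ennreal ?h + ennreal (?b\<^sup>2 / 2) * ennreal ?h"
        using distr[of "?a\<^sup>2 / 2" "?b\<^sup>2 / 2" ?h] h by simp
      finally show "ennreal (cmod (?W p)) \<le> ennreal (?a\<^sup>2 / 2) * ennreal ?h + ennreal (?b\<^sup>2 / 2) * ennreal ?h" .
    qed
    also have "\<dots> = (\<integral>\<^sup>+p. ennreal ((cmod (U (fst p)))\<^sup>2 / 2) * ennreal (heat r (fst p - snd p)) \<partial>(?L \<Otimes>\<^sub>M ?L)) +
        (\<integral>\<^sup>+p. ennreal ((cmod (U (snd p)))\<^sup>2 / 2) * ennreal (heat r (fst p - snd p)) \<partial>(?L \<Otimes>\<^sub>M ?L))"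
      by (rule nn_integral_add) measurable
    also have "(\<integral>\<^sup>+p. ennreal ((cmod (U (fst p)))\<^sup>2 / 2) * ennreal (heat r (fst p - snd p)) \<partial>(?L \<Otimes>\<^sub>M ?L)) =
        (\<integral>\<^sup>+x. ennreal ((cmod (U x))\<^sup>2 / 2) \<partial>?L)"
      by (subst lebesgue.nn_integral_fst[symmetric])
        (simp_all add: nn_integral_cmult nn_integral_heat_lebesgue[OF r])
    also have "(\<integral>\<^sup>+p. ennreal ((cmod (U (snd p)))\<^sup>2 / 2) * ennreal (heat r (fst p - snd p)) \<partial>(?L \<Otimes>\<^sub>M ?L)) =
        (\<integral>\<^sup>+x. ennreal ((cmod (U x))\<^sup>2 / 2) \<partial>?L)"
      by (subst lebesgue_pair.nn_integral_snd[symmetric])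
        (simp_all add: nn_integral_cmult nn_integral_heat_lebesgue[OF r] split_beta')
    also have "(\<integral>\<^sup>+x. ennreal ((cmod (U x))\<^sup>2 / 2) \<partial>?L) + (\<integral>\<^sup>+x. ennreal ((cmod (U x))\<^sup>2 / 2) \<partial>?L) = ?N"
      by (subst nn_integral_add[symmetric]) (auto simp flip: ennreal_plus)
    finally show ?thesis by (simp add: ennreal_leI)
  qed
  have "(\<integral>\<^sup>+\<xi>. ennreal ((cmod (osc_integral c U \<xi>))\<^sup>2) \<partial>lborel) =
     (\<integral>\<^sup>+\<xi>. liminf (\<lambda>n. ennreal ((cmod (osc_integral c U \<xi>))\<^sup>2 * gweight (real (Suc n)) \<xi>)) \<partial>lborel)"
  proof (intro nn_integral_cong)
    fix \<xi> :: "real ^ 'n"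
    have "(\<lambda>n. ennreal ((cmod (osc_integral c U \<xi>))\<^sup>2 * gweight (real (Suc n)) \<xi>)) \<longlonglongrightarrow>
        ennreal ((cmod (osc_integral c U \<xi>))\<^sup>2 * 1)"
      by (intro tendsto_ennrealI tendsto_mult tendsto_const gweight_tendsto)
    then show "ennreal ((cmod (osc_integral c U \<xi>))\<^sup>2) =
        liminf (\<lambda>n. ennreal ((cmod (osc_integral c U \<xi>))\<^sup>2 * gweight (real (Suc n)) \<xi>))"
      by (simp add: lim_imp_Liminf)
  qed
  also have "\<dots> \<le> liminf (\<lambda>n. \<integral>\<^sup>+\<xi>. ennreal ((cmod (osc_integral c U \<xi>))\<^sup>2 * gweight (real (Suc n)) \<xi>) \<partial>lborel)"
    by (rule nn_integral_liminf) measurable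
  also have "\<dots> \<le> liminf (\<lambda>n. ?N)"
    by (intro Liminf_mono always_eventually allI weighted) simp
  finally show ?thesis by (simp add: Liminf_const)
qed

text \<open>
  For the indicator function of an open set of finite measure the reverse inequality holds: all integrands are
  nonnegative, and since \<open>indicator S\<close> is lower semicontinuous, Fatou's lemma bounds the averaged
  correlation from below as the heat kernel concentrates.
\<close>

lemma osc_integral_indicator_open_ge:
  fixes S :: "(real ^ 'n) set"
  assumes c: "\<bar>c\<bar> = 2 * pi" and S: "open S" and fin: "emeasure lebesgue S < \<infinity>"
  shows "emeasure lebesgue S \<le> (\<integral>\<^sup>+\<xi>. ennreal ((cmod (osc_integral c (indicator S) \<xi>))\<^sup>2) \<partial>lborel)"
proof -
  let ?L = "lebesgue :: (real ^ 'n) measure"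
  let ?B = "\<integral>\<^sup>+\<xi>. ennreal ((cmod (osc_integral c (indicator S) \<xi>))\<^sup>2) \<partial>lborel"
  have [measurable]: "S \<in> sets borel" using S by simp
  have "integrable ?L (\<lambda>x. complex_of_real (indicator S x))"
    using fin by (intro integrable_of_real integrable_real_indicator) auto
  moreover have "(\<lambda>x. complex_of_real (indicator S x)) = indicator S"
    by (auto simp: indicator_def)
  ultimately have U: "integrable ?L (indicator S :: _ \<Rightarrow> complex)"
    by simp
  have le: "(\<integral>\<^sup>+x. \<integral>\<^sup>+z. indicator S x * indicator S (x - z /\<^sub>R r) * ennreal (gauss z) \<partial>lborel \<partial>lborel) \<le> ?B"
    if r: "0 < r" for r
  proof -
    let ?w = "\<lambda>p. indicator S (fst p) * indicator S (snd p) * heat r (fst p - snd p) :: real"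
    let ?W = "\<lambda>p. indicator S (fst p) * cnj (indicator S (snd p)) * complex_of_real (heat r (fst p - snd p))"
    have W: "?W p = complex_of_real (?w p)" for p
      by (auto simp: indicator_def)
    have w: "integrable (?L \<Otimes>\<^sub>M ?L) ?w"
      using integrable_heat_correlation[OF r c U] unfolding W complex_of_real_integrable_eq .
    have "(\<integral>\<^sup>+x. \<integral>\<^sup>+z. indicator S x * indicator S (x - z /\<^sub>R r) * ennreal (gauss z) \<partial>lborel \<partial>lborel) =
      (\<integral>\<^sup>+x. indicator S x * (\<integral>\<^sup>+z. indicator S (x - z /\<^sub>R r) * ennreal (gauss z) \<partial>lborel) \<partial>lborel)"
      by (simp add: mult.assoc nn_integral_cmult)
    also have "\<dots> = (\<integral>\<^sup>+x. indicator S x * (\<integral>\<^sup>+y. indicator S y * ennreal (heat r (x - y)) \<partial>lborel) \<partial>lborel)"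
      by (simp add: nn_integral_heat_mult[OF _ r])
    also have "\<dots> = (\<integral>\<^sup>+x. indicator S x * (\<integral>\<^sup>+y. indicator S y * ennreal (heat r (x - y)) \<partial>?L) \<partial>?L)"
      by (simp add: nn_integral_completion)
    also have "\<dots> = (\<integral>\<^sup>+x. \<integral>\<^sup>+y. ennreal (?w (x, y)) \<partial>?L \<partial>?L)"
      by (auto simp: indicator_def nn_integral_cmult intro!: nn_integral_cong)
    also have "\<dots> = (\<integral>\<^sup>+p. ennreal (?w p) \<partial>(?L \<Otimes>\<^sub>M ?L))"
      by (rule lebesgue.nn_integral_fst) measurable
    also have "\<dots> = ennreal (LINT p|(?L \<Otimes>\<^sub>M ?L). ?w p)"
      by (rule nn_integral_eq_integral[OF w]) (auto intro!: AE_I2 mult_nonneg_nonneg heat_nonneg simp: r)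
    also have "(LINT p|(?L \<Otimes>\<^sub>M ?L). ?w p) = (LINT \<xi>|lborel. (cmod (osc_integral c (indicator S) \<xi>))\<^sup>2 * gweight r \<xi>)"
      using integral_gweight_osc_integral[OF r c U] unfolding W integral_complex_of_real of_real_eq_iff by simp
    also have "ennreal \<dots> = (\<integral>\<^sup>+\<xi>. ennreal ((cmod (osc_integral c (indicator S) \<xi>))\<^sup>2 * gweight r \<xi>) \<partial>lborel)"
      using integrable_gweight_osc_integral[OF r c U] unfolding complex_of_real_integrable_eq
      by (intro nn_integral_eq_integral[symmetric]) (auto simp: gweight_bounds)
    also have "\<dots> \<le> ?B"
      by (intro nn_integral_mono ennreal_leI mult_left_le) (auto simp: gweight_bounds)
    finally show ?thesis .
  qed
  let ?f = "\<lambda>n x z. indicator S x * indicator S (x - z /\<^sub>R real (Suc n)) * ennreal (gauss z) :: ennreal"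
  have "emeasure ?L S = (\<integral>\<^sup>+x. indicator S x \<partial>lborel)"
    by simp
  also have "\<dots> = (\<integral>\<^sup>+x. \<integral>\<^sup>+z. indicator S x * ennreal (gauss (z :: real ^ 'n)) \<partial>lborel \<partial>lborel)"
    by (simp add: nn_integral_cmult nn_integral_gauss)
  also have "\<dots> \<le> (\<integral>\<^sup>+x. \<integral>\<^sup>+z. liminf (\<lambda>n. ?f n x z) \<partial>lborel \<partial>lborel)"
  proof (intro nn_integral_mono)
    fix x z :: "real ^ 'n"
    show "indicator S x * ennreal (gauss z) \<le> liminf (\<lambda>n. ?f n x z)"
    proof (cases "x \<in> S")
      case True
      have "(\<lambda>n. x - inverse (real (Suc n)) *\<^sub>R z) \<longlonglongrightarrow> x - 0 *\<^sub>R z"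
        by (intro tendsto_intros LIMSEQ_inverse_real_of_nat)
      then have "\<forall>\<^sub>F n in sequentially. x - z /\<^sub>R real (Suc n) \<in> S"
        using S True by (auto dest!: topological_tendstoD)
      then show ?thesis
        using True by (intro Liminf_bounded) (auto elim: eventually_mono)
    qed simp
  qed
  also have "\<dots> \<le> (\<integral>\<^sup>+x. liminf (\<lambda>n. \<integral>\<^sup>+z. ?f n x z \<partial>lborel) \<partial>lborel)"
    by (intro nn_integral_mono nn_integral_liminf) measurable
  also have "\<dots> \<le> liminf (\<lambda>n. \<integral>\<^sup>+x. \<integral>\<^sup>+z. ?f n x z \<partial>lborel \<partial>lborel)"
    by (intro nn_integral_liminf) measurable
  also have "\<dots> \<le> liminf (\<lambda>n. ?B)"
    by (intro Liminf_mono always_eventually allI le) simp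
  finally show ?thesis by (simp add: Liminf_const)
qed

section \<open>The space of square integrable functions\<close>

lemma borel_measurable_cnj [measurable]: "cnj \<in> borel_measurable borel"
  by (intro borel_measurable_continuous_onI continuous_on_cnj continuous_on_id)

lemma L2_measurable [measurable_dest]: "u \<in> L2 \<Longrightarrow> u \<in> borel_measurable lebesgue"
  by (simp add: L2_def)

lemma L2_integrable: "u \<in> L2 \<Longrightarrow> integrable lebesgue (\<lambda>x. (cmod (u x))\<^sup>2)"
  by (simp add: L2_def)

lemma L2_iff_nn_integral:
  "u \<in> L2 \<longleftrightarrow> u \<in> borel_measurable lebesgue \<and> (\<integral>\<^sup>+x. ennreal ((cmod (u x))\<^sup>2) \<partial>lebesgue) < \<infinity>"
  unfolding L2_def by (auto simp: integrable_iff_bounded)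

lemma L2_norm_square: "(L2_norm u)\<^sup>2 = (LINT x|lebesgue. (cmod (u x))\<^sup>2)"
  by (simp add: L2_norm_def)

lemma L2_norm_nonneg [simp]: "0 \<le> L2_norm u"
  by (simp add: L2_norm_def)

lemma nn_integral_L2_norm:
  "u \<in> L2 \<Longrightarrow> (\<integral>\<^sup>+x. ennreal ((cmod (u x))\<^sup>2) \<partial>lebesgue) = ennreal ((L2_norm u)\<^sup>2)"
  unfolding L2_norm_square by (rule nn_integral_eq_integral) (auto dest: L2_integrable)

text \<open>
  The form in which bounds obtained from Tonelli and Fatou enter: a bound on the nonnegative
  integral gives membership in \<open>L2\<close> and the norm estimate at once.
\<close>

lemma L2_nn_integral_bound:
  assumes "u \<in> borel_measurable lebesgue" "0 \<le> B"
    and "(\<integral>\<^sup>+x. ennreal ((cmod (u x))\<^sup>2) \<partial>lebesgue) \<le> ennreal (B\<^sup>2)"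
  shows "u \<in> L2" and "L2_norm u \<le> B"
proof -
  show u: "u \<in> L2"
    using assms(1) le_less_trans[OF assms(3) ennreal_less_top] by (simp add: L2_iff_nn_integral)
  show "L2_norm u \<le> B"
  proof (rule power2_le_imp_le)
    show "(L2_norm u)\<^sup>2 \<le> B\<^sup>2"
      using assms(3) unfolding nn_integral_L2_norm[OF u] by (simp add: ennreal_le_iff)
  qed (rule assms)
qed

lemma L2_bounded:
  assumes u: "u \<in> L2" and v: "v \<in> borel_measurable lebesgue"
    and le: "AE x in lebesgue. cmod (v x) \<le> C * cmod (u x)"
  shows "v \<in> L2"
proof -
  have "integrable lebesgue (\<lambda>x. (cmod (v x))\<^sup>2)"
  proof (rule Bochner_Integration.integrable_bound)
    show "integrable lebesgue (\<lambda>x. C\<^sup>2 * (cmod (u x))\<^sup>2)"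
      using L2_integrable[OF u] by simp
    show "AE x in lebesgue. norm ((cmod (v x))\<^sup>2) \<le> norm (C\<^sup>2 * (cmod (u x))\<^sup>2)"
      using le
    proof eventually_elim
      case (elim x)
      then have "(cmod (v x))\<^sup>2 \<le> (C * cmod (u x))\<^sup>2"
        by (intro power_mono) auto
      then show ?case by (simp add: power_mult_distrib)
    qed
  qed (use v in measurable)
  then show ?thesis using v by (simp add: L2_def)
qed

lemma L2_scale: "u \<in> L2 \<Longrightarrow> (\<lambda>x. a * u x) \<in> L2"
  by (rule L2_bounded[where C="cmod a" and u=u]) (auto simp: norm_mult)

lemma L2_cong_AE:
  assumes "u \<in> L2" "v \<in> borel_measurable lebesgue" "AE x in lebesgue. u x = v x"
  shows "v \<in> L2"
  by (rule L2_bounded[OF assms(1,2), of 1]) (use assms(3) in eventually_elim, simp)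

lemma L2_add:
  assumes u: "u \<in> L2" and v: "v \<in> L2"
  shows "(\<lambda>x. u x + v x) \<in> L2"
proof -
  note [measurable] = L2_measurable[OF u] L2_measurable[OF v]
  have "integrable lebesgue (\<lambda>x. (cmod (u x + v x))\<^sup>2)"
  proof (rule Bochner_Integration.integrable_bound)
    show "integrable lebesgue (\<lambda>x. 2 * (cmod (u x))\<^sup>2 + 2 * (cmod (v x))\<^sup>2)"
      using L2_integrable[OF u] L2_integrable[OF v] by simp
    have "(cmod (a + b))\<^sup>2 \<le> 2 * (cmod a)\<^sup>2 + 2 * (cmod b)\<^sup>2" for a b :: complex
    proof -
      have "(cmod (a + b))\<^sup>2 \<le> (cmod a + cmod b)\<^sup>2"
        by (intro power_mono norm_triangle_ineq) auto
      also have "\<dots> \<le> 2 * (cmod a)\<^sup>2 + 2 * (cmod b)\<^sup>2"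
        using sum_squares_bound[of "cmod a" "cmod b"] by (simp add: power2_sum)
      finally show ?thesis .
    qed
    then show "AE x in lebesgue. norm ((cmod (u x + v x))\<^sup>2) \<le> norm (2 * (cmod (u x))\<^sup>2 + 2 * (cmod (v x))\<^sup>2)"
      by auto
  qed measurable
  then show ?thesis by (simp add: L2_def)
qed

lemma L2_diff: "u \<in> L2 \<Longrightarrow> v \<in> L2 \<Longrightarrow> (\<lambda>x. u x - v x) \<in> L2"
  using L2_add[of u "\<lambda>x. (- 1) * v x"] L2_scale[of v "- 1"] by simp

lemma L2_inner_integrable:
  assumes u: "u \<in> L2" and v: "v \<in> L2"
  shows "integrable lebesgue (\<lambda>x. u x * cnj (v x))"
proof (rule Bochner_Integration.integrable_bound)
  note [measurable] = L2_measurable[OF u] L2_measurable[OF v]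
  show "integrable lebesgue (\<lambda>x. (cmod (u x))\<^sup>2 + (cmod (v x))\<^sup>2)"
    using L2_integrable[OF u] L2_integrable[OF v] by simp
  have "cmod a * cmod b \<le> (cmod a)\<^sup>2 + (cmod b)\<^sup>2" for a b
  proof -
    have "0 \<le> cmod a * cmod b" by simp
    then show ?thesis
      using sum_squares_bound[of "cmod a" "cmod b"] by linarith
  qed
  then show "AE x in lebesgue. norm (u x * cnj (v x)) \<le> norm ((cmod (u x))\<^sup>2 + (cmod (v x))\<^sup>2)"
    by (simp add: norm_mult)
  show "(\<lambda>x. u x * cnj (v x)) \<in> borel_measurable lebesgue" by measurable
qed

lemma L2_norm_eq_0_iff:
  assumes u: "u \<in> L2"
  shows "L2_norm u = 0 \<longleftrightarrow> (AE x in lebesgue. u x = 0)"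
  using integral_nonneg_eq_0_iff_AE[OF L2_integrable[OF u]] by (simp add: L2_norm_def)

lemma L2_norm_cong_AE:
  assumes "u \<in> borel_measurable lebesgue" "v \<in> borel_measurable lebesgue"
    and "AE x in lebesgue. u x = v x"
  shows "L2_norm u = L2_norm v"
  unfolding L2_norm_def
  by (intro arg_cong[where f=sqrt] integral_cong_AE) (use assms in \<open>auto elim!: eventually_mono\<close>)

lemma L2_inner_self: "L2_inner u u = complex_of_real ((L2_norm u)\<^sup>2)"
  unfolding L2_inner_def L2_norm_square complex_norm_square[symmetric] by (simp del: of_real_power)

lemma Re_L2_inner_self: "Re (L2_inner u u) = (L2_norm u)\<^sup>2"
  unfolding L2_inner_self Re_complex_of_real ..

lemma L2_inner_commute: "L2_inner u v = cnj (L2_inner v u)"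
  unfolding L2_inner_def by (subst Bochner_Integration.integral_cnj[symmetric]) (simp add: mult.commute)

lemma L2_inner_diff_left:
  "u \<in> L2 \<Longrightarrow> v \<in> L2 \<Longrightarrow> w \<in> L2 \<Longrightarrow> L2_inner (\<lambda>x. u x - v x) w = L2_inner u w - L2_inner v w"
  unfolding L2_inner_def left_diff_distrib
  by (intro Bochner_Integration.integral_diff L2_inner_integrable)

lemma L2_inner_diff_right:
  "u \<in> L2 \<Longrightarrow> v \<in> L2 \<Longrightarrow> w \<in> L2 \<Longrightarrow> L2_inner w (\<lambda>x. u x - v x) = L2_inner w u - L2_inner w v"
  by (simp add: L2_inner_commute[of w] L2_inner_diff_left)

lemma L2_norm_diff_square:
  assumes "u \<in> L2" "v \<in> L2"
  shows "(L2_norm (\<lambda>x. u x - v x))\<^sup>2 = (L2_norm u)\<^sup>2 - 2 * Re (L2_inner u v) + (L2_norm v)\<^sup>2"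
proof -
  let ?w = "\<lambda>x. u x - v x"
  have "L2_inner ?w ?w = L2_inner u u - L2_inner u v - (L2_inner v u - L2_inner v v)"
    using assms by (simp add: L2_inner_diff_left L2_inner_diff_right L2_diff)
  then have "Re (L2_inner ?w ?w) =
      Re (L2_inner u u) - Re (L2_inner u v) - (Re (L2_inner v u) - Re (L2_inner v v))"
    by simp
  moreover have "Re (L2_inner v u) = Re (L2_inner u v)"
    by (subst L2_inner_commute) simp
  ultimately show ?thesis
    by (simp add: Re_L2_inner_self)
qed

lemma L2_Cauchy_Schwarz:
  assumes u: "u \<in> L2" and v: "v \<in> L2"
  shows "cmod (L2_inner u v) \<le> L2_norm u * L2_norm v"
proof -
  note [measurable] = L2_measurable[OF u] L2_measurable[OF v]
  let ?I = "\<integral>\<^sup>+x. ennreal (cmod (u x)) * ennreal (cmod (v x)) \<partial>lebesgue"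
  have "ennreal (cmod (L2_inner u v)) \<le> (\<integral>\<^sup>+x. ennreal (cmod (u x * cnj (v x))) \<partial>lebesgue)"
    unfolding L2_inner_def by (rule integral_norm_bound_ennreal[OF L2_inner_integrable[OF u v]])
  also have "\<dots> = ?I"
    by (simp add: norm_mult ennreal_mult)
  finally have "(ennreal (cmod (L2_inner u v)))\<^sup>2 \<le> ?I\<^sup>2"
    by (rule power_mono) simp
  also have "\<dots> \<le> (\<integral>\<^sup>+x. (ennreal (cmod (u x)))\<^sup>2 \<partial>lebesgue) * (\<integral>\<^sup>+x. (ennreal (cmod (v x)))\<^sup>2 \<partial>lebesgue)"
    by (rule Cauchy_Schwarz_nn_integral) measurable
  also have "\<dots> = ennreal ((L2_norm u)\<^sup>2) * ennreal ((L2_norm v)\<^sup>2)"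
    by (simp add: ennreal_power nn_integral_L2_norm u v)
  finally have "(cmod (L2_inner u v))\<^sup>2 \<le> (L2_norm u * L2_norm v)\<^sup>2"
    by (simp add: ennreal_power power_mult_distrib flip: ennreal_mult)
  then show ?thesis
    by (rule power2_le_imp_le) simp
qed

lemma L2_norm_diff_triangle:
  assumes u: "u \<in> L2" and v: "v \<in> L2"
  shows "L2_norm (\<lambda>x. u x - v x) \<le> L2_norm u + L2_norm v"
proof (rule power2_le_imp_le)
  have "- Re (L2_inner u v) \<le> L2_norm u * L2_norm v"
    using L2_Cauchy_Schwarz[OF u v] abs_Re_le_cmod[of "L2_inner u v"] by linarith
  then show "(L2_norm (\<lambda>x. u x - v x))\<^sup>2 \<le> (L2_norm u + L2_norm v)\<^sup>2"
    unfolding L2_norm_diff_square[OF u v] by (simp add: power2_sum)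
qed simp

lemma L2_norm_minus_commute: "L2_norm (\<lambda>x. u x - v x) = L2_norm (\<lambda>x. v x - u x)"
  unfolding L2_norm_def by (simp add: norm_minus_commute)

lemma L2_norm_triangle_mid:
  assumes "u \<in> L2" "v \<in> L2" "w \<in> L2"
  shows "L2_norm (\<lambda>x. u x - w x) \<le> L2_norm (\<lambda>x. u x - v x) + L2_norm (\<lambda>x. v x - w x)"
  using L2_norm_diff_triangle[OF L2_diff[OF assms(1,2)] L2_diff[OF assms(3,2)]]
  by (simp add: L2_norm_minus_commute[of w v])

lemma L2_norm_diff_bound:
  assumes "u \<in> L2" "v \<in> L2"
  shows "\<bar>L2_norm u - L2_norm v\<bar> \<le> L2_norm (\<lambda>x. u x - v x)"
  using L2_norm_triangle_mid[OF assms, of "\<lambda>_. 0"] L2_norm_triangle_mid[OF assms(2,1), of "\<lambda>_. 0"]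
    L2_scale[OF assms(1), of 0] L2_norm_minus_commute[of u v]
  by simp

lemma L2_norm_tendsto:
  assumes "\<And>n. U n \<in> L2" "u \<in> L2" "(\<lambda>n. L2_norm (\<lambda>x. U n x - u x)) \<longlonglongrightarrow> 0"
  shows "(\<lambda>n. L2_norm (U n)) \<longlonglongrightarrow> L2_norm u"
proof -
  have "(\<lambda>n. L2_norm (U n) - L2_norm u) \<longlonglongrightarrow> 0"
    by (rule Lim_null_comparison[OF _ assms(3)])
      (use L2_norm_diff_bound[OF assms(1,2)] in simp)
  then show ?thesis by (simp add: LIM_zero_iff)
qed

lemma L2_inner_tendsto:
  assumes U: "\<And>n. U n \<in> L2" "u \<in> L2" "(\<lambda>n. L2_norm (\<lambda>x. U n x - u x)) \<longlonglongrightarrow> 0"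
    and V: "\<And>n. V n \<in> L2" "v \<in> L2" "(\<lambda>n. L2_norm (\<lambda>x. V n x - v x)) \<longlonglongrightarrow> 0"
  shows "(\<lambda>n. L2_inner (U n) (V n)) \<longlonglongrightarrow> L2_inner u v"
proof -
  have "(\<lambda>n. L2_inner (U n) (V n) - L2_inner u v) \<longlonglongrightarrow> 0"
  proof (rule Lim_null_comparison)
    show "\<forall>\<^sub>F n in sequentially. norm (L2_inner (U n) (V n) - L2_inner u v) \<le>
        L2_norm (\<lambda>x. U n x - u x) * L2_norm (V n) + L2_norm u * L2_norm (\<lambda>x. V n x - v x)"
    proof (intro always_eventually allI)
      fix n
      have "L2_inner (U n) (V n) - L2_inner u v =
          L2_inner (\<lambda>x. U n x - u x) (V n) + L2_inner u (\<lambda>x. V n x - v x)"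
        using U V by (simp add: L2_inner_diff_left L2_inner_diff_right)
      then show "norm (L2_inner (U n) (V n) - L2_inner u v) \<le>
        L2_norm (\<lambda>x. U n x - u x) * L2_norm (V n) + L2_norm u * L2_norm (\<lambda>x. V n x - v x)"
        using U V by (auto intro!: order_trans[OF norm_triangle_ineq] add_mono L2_Cauchy_Schwarz L2_diff)
    qed
    have "(\<lambda>n. L2_norm (\<lambda>x. U n x - u x) * L2_norm (V n) + L2_norm u * L2_norm (\<lambda>x. V n x - v x))
      \<longlonglongrightarrow> 0 * L2_norm v + L2_norm u * 0"
      by (intro tendsto_intros U V L2_norm_tendsto)
    then show "(\<lambda>n. L2_norm (\<lambda>x. U n x - u x) * L2_norm (V n) + L2_norm u * L2_norm (\<lambda>x. V n x - v x))
      \<longlonglongrightarrow> 0" by simp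
  qed
  then show ?thesis by (simp add: LIM_zero_iff)
qed

text \<open>
  Riesz--Fischer. Along a rapidly converging subsequence the increments \<open>d n\<close> satisfy
  \<open>L2_norm (d n) \<le> 4\<^sup>-\<^sup>n\<close>, so \<open>\<Sum>n. 4\<^sup>n * (cmod (d n x))\<^sup>2\<close> is finite almost everywhere and the
  subsequence converges there geometrically; Fatou's lemma turns the pointwise limit into a limit
  in norm.
\<close>

lemma L2_complete:
  fixes f :: "nat \<Rightarrow> real ^ 'n \<Rightarrow> complex"
  assumes f: "\<And>n. f n \<in> L2"
    and Cauchy: "\<And>e. 0 < e \<Longrightarrow> \<exists>M. \<forall>i\<ge>M. \<forall>j\<ge>M. L2_norm (\<lambda>x. f i x - f j x) < e"
  obtains g where "g \<in> L2" "(\<lambda>n. L2_norm (\<lambda>x. f n x - g x)) \<longlonglongrightarrow> 0"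
proof -
  note [measurable] = L2_measurable[OF f]
  have "\<forall>n. \<exists>M. \<forall>i\<ge>M. \<forall>j\<ge>M. L2_norm (\<lambda>x. f i x - f j x) < (1/4) ^ n"
    by (intro allI Cauchy) simp
  then obtain M where M: "\<And>n i j. M n \<le> i \<Longrightarrow> M n \<le> j \<Longrightarrow> L2_norm (\<lambda>x. f i x - f j x) < (1/4) ^ n"
    by metis
  \<comment> \<open>the sum makes \<open>k m\<close> at least \<open>M n\<close> for all \<open>n \<le> m\<close>; the summand \<open>n\<close> makes \<open>k\<close> unbounded\<close>
  define k where "k n = n + (\<Sum>i\<le>n. M i)" for n
  have k: "M n \<le> k m" if "n \<le> m" for n m
  proof -
    have "M n \<le> (\<Sum>i\<le>m. M i)" using that by (intro member_le_sum) auto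
    then show ?thesis by (simp add: k_def)
  qed
  have four_power: "((2::real) ^ n)\<^sup>2 = 4 ^ n" for n
    using power_mult[of "2::real" 2 n] by (simp add: power_mult[symmetric] mult.commute)
  define d where "d n x = f (k (Suc n)) x - f (k n) x" for n x
  have d: "d n \<in> L2" "L2_norm (d n) \<le> (1/4) ^ n" for n
    unfolding d_def using M[OF k k, of n "Suc n" n] by (auto intro: L2_diff f less_imp_le)
  note [measurable] = L2_measurable[OF d(1)]
  have "(\<integral>\<^sup>+x. (\<Sum>n. ennreal (4 ^ n * (cmod (d n x))\<^sup>2)) \<partial>lebesgue) =
      (\<Sum>n. \<integral>\<^sup>+x. ennreal (4 ^ n * (cmod (d n x))\<^sup>2) \<partial>lebesgue)"
    by (rule nn_integral_suminf) measurable
  also have "\<dots> \<le> (\<Sum>n. ennreal ((1/4) ^ n))"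
  proof (rule suminf_le)
    fix n
    have "(\<integral>\<^sup>+x. ennreal (4 ^ n * (cmod (d n x))\<^sup>2) \<partial>lebesgue) = ennreal (4 ^ n * (L2_norm (d n))\<^sup>2)"
      by (simp add: ennreal_mult nn_integral_cmult nn_integral_L2_norm[OF d(1)])
    also have "\<dots> \<le> ennreal (4 ^ n * ((1/4) ^ n)\<^sup>2)"
      by (intro ennreal_leI mult_left_mono power_mono d) auto
    also have "4 ^ n * ((1/4) ^ n)\<^sup>2 = (1/4 :: real) ^ n"
      by (simp add: power2_eq_square power_divide)
    finally show "(\<integral>\<^sup>+x. ennreal (4 ^ n * (cmod (d n x))\<^sup>2) \<partial>lebesgue) \<le> ennreal ((1/4) ^ n)" .
  qed auto
  also have "\<dots> < \<infinity>"
    by (subst suminf_ennreal2) (auto intro: summable_geometric)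
  finally have "AE x in lebesgue. (\<Sum>n. ennreal (4 ^ n * (cmod (d n x))\<^sup>2)) \<noteq> \<infinity>"
    by (intro nn_integral_PInf_AE) auto
  then have conv: "AE x in lebesgue. convergent (\<lambda>n. f (k n) x)"
  proof eventually_elim
    case (elim x)
    define S where "S = enn2real (\<Sum>n. ennreal (4 ^ n * (cmod (d n x))\<^sup>2))"
    have S_nonneg: "0 \<le> S" by (simp add: S_def)
    have term_le_suminf: "t n \<le> suminf t" for t :: "nat \<Rightarrow> ennreal" and n
      using sum_le_suminf[of t "{n}"] by simp
    have bound: "cmod (d n x) \<le> sqrt S * (1/2) ^ n" for n
    proof -
      have "ennreal (4 ^ n * (cmod (d n x))\<^sup>2) \<le> (\<Sum>n. ennreal (4 ^ n * (cmod (d n x))\<^sup>2))"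
        by (rule term_le_suminf)
      also have "\<dots> = ennreal S"
        using elim by (simp add: S_def less_top)
      finally have "4 ^ n * (cmod (d n x))\<^sup>2 \<le> S"
        using S_nonneg by (simp only: ennreal_le_iff)
      moreover have "(2 ^ n * cmod (d n x))\<^sup>2 = 4 ^ n * (cmod (d n x))\<^sup>2"
        by (simp add: power_mult_distrib four_power)
      ultimately have "2 ^ n * cmod (d n x) \<le> sqrt S"
        by (intro real_le_rsqrt) simp
      then show ?thesis by (simp add: power_divide field_simps)
    qed
    have "summable (\<lambda>n. d n x)"
      by (rule summable_comparison_test'[OF _ bound]) (intro summable_mult summable_geometric, simp)
    then have "convergent (\<lambda>n. \<Sum>i<n. d i x)"
      by (simp add: summable_iff_convergent)
    then have "convergent (\<lambda>n. (\<Sum>i<n. d i x) + f (k 0) x)"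
      by (intro convergent_add convergent_const)
    then show ?case
      unfolding d_def sum_lessThan_telescope[of "\<lambda>i. f (k i) x"] by simp
  qed
  define g where "g x = lim (\<lambda>n. f (k n) x)" for x
  have [measurable]: "g \<in> borel_measurable lebesgue"
    unfolding g_def by (rule borel_measurable_lim_metric) measurable
  have lim: "AE x in lebesgue. (\<lambda>n. f (k n) x) \<longlonglongrightarrow> g x"
    using conv by (simp add: g_def convergent_LIMSEQ_iff)
  have close: "(\<lambda>x. f m x - g x) \<in> L2 \<and> L2_norm (\<lambda>x. f m x - g x) \<le> e"
    if e: "0 < e" and N: "\<forall>i\<ge>N. \<forall>j\<ge>N. L2_norm (\<lambda>x. f i x - f j x) < e" and m: "N \<le> m" for e m N
  proof -
    have "(\<integral>\<^sup>+x. ennreal ((cmod (f m x - g x))\<^sup>2) \<partial>lebesgue) =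
        (\<integral>\<^sup>+x. liminf (\<lambda>n. ennreal ((cmod (f m x - f (k n) x))\<^sup>2)) \<partial>lebesgue)"
    proof (rule nn_integral_cong_AE)
      show "AE x in lebesgue. ennreal ((cmod (f m x - g x))\<^sup>2) =
          liminf (\<lambda>n. ennreal ((cmod (f m x - f (k n) x))\<^sup>2))"
        using lim
      proof eventually_elim
        case (elim x)
        then have "(\<lambda>n. ennreal ((cmod (f m x - f (k n) x))\<^sup>2)) \<longlonglongrightarrow> ennreal ((cmod (f m x - g x))\<^sup>2)"
          by (intro tendsto_ennrealI tendsto_power tendsto_norm tendsto_diff tendsto_const)
        then show ?case by (rule lim_imp_Liminf[symmetric, rotated]) simp
      qed
    qed
    also have "\<dots> \<le> liminf (\<lambda>n. \<integral>\<^sup>+x. ennreal ((cmod (f m x - f (k n) x))\<^sup>2) \<partial>lebesgue)"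
      by (rule nn_integral_liminf) measurable
    also have "\<dots> = liminf (\<lambda>n. ennreal ((L2_norm (\<lambda>x. f m x - f (k n) x))\<^sup>2))"
      by (simp add: nn_integral_L2_norm L2_diff f)
    also have "\<dots> \<le> liminf (\<lambda>n. ennreal (e\<^sup>2))"
    proof (rule Liminf_mono)
      show "\<forall>\<^sub>F n in sequentially. ennreal ((L2_norm (\<lambda>x. f m x - f (k n) x))\<^sup>2) \<le> ennreal (e\<^sup>2)"
        using eventually_ge_at_top[of N]
      proof eventually_elim
        case (elim n)
        then have "L2_norm (\<lambda>x. f m x - f (k n) x) < e"
          using N m by (simp add: k_def)
        then show ?case by (intro ennreal_leI power_mono) auto
      qed
    qed
    finally have "(\<integral>\<^sup>+x. ennreal ((cmod (f m x - g x))\<^sup>2) \<partial>lebesgue) \<le> ennreal (e\<^sup>2)"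
      by (simp add: Liminf_const)
    then show ?thesis
      using L2_nn_integral_bound[of "\<lambda>x. f m x - g x" e] e by simp
  qed
  show thesis
  proof
    obtain N where "\<forall>i\<ge>N. \<forall>j\<ge>N. L2_norm (\<lambda>x. f i x - f j x) < 1"
      using Cauchy[of 1] by auto
    then have "(\<lambda>x. f N x - g x) \<in> L2" using close[of 1 N N] by simp
    from L2_diff[OF f[of N] this] show g: "g \<in> L2" by simp
    show "(\<lambda>n. L2_norm (\<lambda>x. f n x - g x)) \<longlonglongrightarrow> 0"
    proof (rule LIMSEQ_I)
      fix e :: real assume e: "0 < e"
      obtain N where "\<forall>i\<ge>N. \<forall>j\<ge>N. L2_norm (\<lambda>x. f i x - f j x) < e / 2"
        using Cauchy[of "e / 2"] e by auto
      then have le: "L2_norm (\<lambda>x. f n x - g x) \<le> e / 2" if "N \<le> n" for n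
        using close[of "e / 2" N n] e that by auto
      have "e / 2 < e" using e by simp
      then have "L2_norm (\<lambda>x. f n x - g x) < e" if "N \<le> n" for n
        by (rule le_less_trans[OF le[OF that]])
      then show "\<exists>N. \<forall>n\<ge>N. norm (L2_norm (\<lambda>x. f n x - g x) - 0) < e"
        by (intro exI[of _ N]) simp
    qed
  qed
qed

text \<open>
  Restricting to growing balls approximates any element of \<open>L2\<close> by integrable ones.
\<close>

lemma L2_truncation:
  fixes u :: "real ^ 'n \<Rightarrow> complex"
  assumes u: "u \<in> L2"
  obtains U where "\<And>n. integrable lebesgue (U n)" "\<And>n. U n \<in> L2"
    "(\<lambda>n. L2_norm (\<lambda>x. U n x - u x)) \<longlonglongrightarrow> 0"
proof
  let ?U = "\<lambda>(n::nat) x. indicator (cball 0 (real n)) x * u x"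
  note [measurable] = L2_measurable[OF u]
  have [measurable]: "(indicator (cball 0 (real n)) :: real ^ 'n \<Rightarrow> complex) \<in> borel_measurable lebesgue" for n
    by (rule borel_measurable_indicator) simp
  show UL2: "?U n \<in> L2" for n
  proof (rule L2_bounded[OF u, of _ 1])
    show "?U n \<in> borel_measurable lebesgue" by measurable
    show "AE x in lebesgue. cmod (?U n x) \<le> 1 * cmod (u x)" by (auto simp: indicator_def)
  qed
  show "integrable lebesgue (?U n)" for n
  proof (rule Bochner_Integration.integrable_bound)
    have "integrable lebesgue (indicator (cball 0 (real n)) :: real ^ 'n \<Rightarrow> real)"
      by (rule integrable_real_indicator) (use emeasure_bounded_finite[OF bounded_cball] in auto)
    then show "integrable lebesgue (\<lambda>x. indicator (cball 0 (real n)) x + (cmod (u x))\<^sup>2)"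
      using L2_integrable[OF u] by simp
    have "a \<le> 1 + a\<^sup>2" for a :: real
    proof -
      have "2 * a \<le> 1 + a\<^sup>2" "0 \<le> a\<^sup>2"
        using zero_le_power2[of "a - 1"] by (simp_all add: power2_diff)
      then show ?thesis by linarith
    qed
    then show "AE x in lebesgue. norm (?U n x) \<le> norm (indicator (cball 0 (real n)) x + (cmod (u x))\<^sup>2)"
      by (auto simp: indicator_def)
  qed measurable
  have "(\<lambda>n. LINT x|lebesgue. (cmod (?U n x - u x))\<^sup>2) \<longlonglongrightarrow> (LINT x|(lebesgue :: (real ^ 'n) measure). (0::real))" 
  proof (rule integral_dominated_convergence[where w="\<lambda>x. (cmod (u x))\<^sup>2"])
    show "AE x in lebesgue. (\<lambda>n. (cmod (?U n x - u x))\<^sup>2) \<longlonglongrightarrow> 0"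
    proof (rule AE_I2)
      fix x :: "real ^ 'n"
      have "\<forall>\<^sub>F n in sequentially. norm x \<le> real n"
        by (rule eventually_sequentiallyI[of "nat \<lceil>norm x\<rceil>"]) linarith
      then have "\<forall>\<^sub>F n in sequentially. (cmod (?U n x - u x))\<^sup>2 = 0"
        by eventually_elim simp
      then show "(\<lambda>n. (cmod (?U n x - u x))\<^sup>2) \<longlonglongrightarrow> 0"
        by (rule tendsto_eventually)
    qed
    show "AE x in lebesgue. norm ((cmod (?U n x - u x))\<^sup>2) \<le> (cmod (u x))\<^sup>2" for n
      by (auto simp: indicator_def)
  qed (use L2_integrable[OF u] in auto)
  from tendsto_real_sqrt[OF this] show "(\<lambda>n. L2_norm (\<lambda>x. ?U n x - u x)) \<longlonglongrightarrow> 0"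
    by (simp add: L2_norm_def)
qed

section \<open>Extension to square integrable functions, inversion and Plancherel\<close>

lemma osc_integral_L2:
  fixes U :: "real ^ 'n \<Rightarrow> complex"
  assumes c: "\<bar>c\<bar> = 2 * pi" and U: "integrable lebesgue U" "U \<in> L2"
  shows "osc_integral c U \<in> L2" and "L2_norm (osc_integral c U) \<le> L2_norm U"
proof -
  have m: "osc_integral c U \<in> borel_measurable lebesgue"
    using U by (intro measurable_completion) simp
  have "(\<integral>\<^sup>+\<xi>. ennreal ((cmod (osc_integral c U \<xi>))\<^sup>2) \<partial>lebesgue) \<le> ennreal ((L2_norm U)\<^sup>2)"
    using osc_integral_bessel[OF c U(1)] unfolding nn_integral_L2_norm[OF U(2)]
    by (simp only: nn_integral_completion)
  from L2_nn_integral_bound[OF m L2_norm_nonneg this]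
  show "osc_integral c U \<in> L2" "L2_norm (osc_integral c U) \<le> L2_norm U" .
qed

lemma osc_integral_diff:
  assumes "integrable lebesgue U" "integrable lebesgue V"
  shows "osc_integral c (\<lambda>x. U x - V x) = (\<lambda>\<xi>. osc_integral c U \<xi> - osc_integral c V \<xi>)"
  by (intro ext)
    (simp add: osc_integral_def right_diff_distrib Bochner_Integration.integral_diff integrable_cis_mult assms)

lemma osc_integral_adjoint:
  fixes U V :: "real ^ 'n \<Rightarrow> complex"
  assumes U: "integrable lebesgue U" and V: "integrable lebesgue V"
  shows "L2_inner (osc_integral c U) V = L2_inner U (osc_integral (- c) V)"
proof -
  let ?L = "lebesgue :: (real ^ 'n) measure"
  note [measurable] = borel_measurable_integrable[OF U] borel_measurable_integrable[OF V]
  define F where "F = (\<lambda>x \<xi>. cis (c * (\<xi> \<bullet> x)) * (U x * cnj (V \<xi>)))"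
  have F: "integrable (?L \<Otimes>\<^sub>M ?L) (case_prod F)"
  proof (rule Bochner_Integration.integrable_bound)
    have "integrable ?L (\<lambda>x. cnj (V x))" using V by simp
    from lebesgue_pair.integrable_times[OF U this]
    show "integrable (?L \<Otimes>\<^sub>M ?L) (\<lambda>p. U (fst p) * cnj (V (snd p)))" .
    show "case_prod F \<in> borel_measurable (?L \<Otimes>\<^sub>M ?L)"
      unfolding F_def by measurable
    show "AE p in ?L \<Otimes>\<^sub>M ?L. norm (case_prod F p) \<le> norm (U (fst p) * cnj (V (snd p)))"
      by (auto simp: F_def norm_mult split: prod.splits)
  qed
  have "L2_inner (osc_integral c U) V = (LINT \<xi>|?L. LINT x|?L. F x \<xi>)"
    unfolding L2_inner_def osc_integral_def F_def by (simp flip: mult.assoc)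
  also have "\<dots> = (LINT x|?L. LINT \<xi>|?L. F x \<xi>)"
    by (rule lebesgue_pair.Fubini_integral[OF F])
  also have "\<dots> = (LINT x|?L. U x * (LINT \<xi>|?L. cnj (cis (- c * (x \<bullet> \<xi>)) * V \<xi>)))"
    by (simp add: F_def cis_cnj inner_commute mult.left_commute[of "cis _"])
  also have "\<dots> = L2_inner U (osc_integral (- c) V)"
    unfolding L2_inner_def osc_integral_def by (simp only: Bochner_Integration.integral_cnj)
  finally show ?thesis .
qed

lemma L2_extends_in_L2:
  assumes "L2_extends_to T u g"
  shows "u \<in> L2" and "g \<in> L2"
  using assms by (simp_all add: L2_extends_to_def)

text \<open>
  On integrable elements of \<open>L2\<close> the extension is given by the integral itself.
\<close>

lemma L2_extends_integrable:
  assumes "\<bar>c\<bar> = 2 * pi" "integrable lebesgue U" "U \<in> L2"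
  shows "L2_extends_to (osc_integral c) U (osc_integral c U)"
  unfolding L2_extends_to_def
  using assms osc_integral_L2[OF assms] by (intro conjI exI[of _ "\<lambda>_. U"]) (auto simp: L2_norm_def)

lemma L2_norm_tendsto_diff:
  assumes "\<And>n. U n \<in> L2" "u \<in> L2" "(\<lambda>n. L2_norm (\<lambda>x. U n x - u x)) \<longlonglongrightarrow> 0"
    and "\<And>n. V n \<in> L2" "v \<in> L2" "(\<lambda>n. L2_norm (\<lambda>x. V n x - v x)) \<longlonglongrightarrow> 0"
  shows "(\<lambda>n. L2_norm (\<lambda>x. (U n x - V n x) - (u x - v x))) \<longlonglongrightarrow> 0"
proof (rule Lim_null_comparison)
  show "(\<lambda>n. L2_norm (\<lambda>x. U n x - u x) + L2_norm (\<lambda>x. V n x - v x)) \<longlonglongrightarrow> 0"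
    using tendsto_add[OF assms(3,6)] by simp
  show "\<forall>\<^sub>F n in sequentially. norm (L2_norm (\<lambda>x. (U n x - V n x) - (u x - v x))) \<le>
      L2_norm (\<lambda>x. U n x - u x) + L2_norm (\<lambda>x. V n x - v x)"
  proof (intro always_eventually allI)
    fix n
    have "L2_norm (\<lambda>x. (U n x - u x) - (V n x - v x)) \<le> L2_norm (\<lambda>x. U n x - u x) + L2_norm (\<lambda>x. V n x - v x)"
      using assms by (intro L2_norm_diff_triangle L2_diff)
    moreover have "(\<lambda>x. (U n x - u x) - (V n x - v x)) = (\<lambda>x. (U n x - V n x) - (u x - v x))"
      by (simp add: algebra_simps)
    ultimately show "norm (L2_norm (\<lambda>x. (U n x - V n x) - (u x - v x))) \<le>
      L2_norm (\<lambda>x. U n x - u x) + L2_norm (\<lambda>x. V n x - v x)"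
      by simp
  qed
qed

lemma L2_extends_diff:
  assumes u: "L2_extends_to (osc_integral c) u g" and v: "L2_extends_to (osc_integral c) v h"
  shows "L2_extends_to (osc_integral c) (\<lambda>x. u x - v x) (\<lambda>x. g x - h x)"
proof -
  obtain U where U: "\<And>n::nat. integrable lebesgue (U n)" "\<And>n. U n \<in> L2" "\<And>n. osc_integral c (U n) \<in> L2"
    "(\<lambda>n. L2_norm (\<lambda>x. U n x - u x)) \<longlonglongrightarrow> 0" "(\<lambda>n. L2_norm (\<lambda>\<xi>. osc_integral c (U n) \<xi> - g \<xi>)) \<longlonglongrightarrow> 0"
    using u by (auto simp: L2_extends_to_def)
  obtain V where V: "\<And>n::nat. integrable lebesgue (V n)" "\<And>n. V n \<in> L2" "\<And>n. osc_integral c (V n) \<in> L2"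
    "(\<lambda>n. L2_norm (\<lambda>x. V n x - v x)) \<longlonglongrightarrow> 0" "(\<lambda>n. L2_norm (\<lambda>\<xi>. osc_integral c (V n) \<xi> - h \<xi>)) \<longlonglongrightarrow> 0"
    using v by (auto simp: L2_extends_to_def)
  note L2 = L2_extends_in_L2[OF u] L2_extends_in_L2[OF v]
  let ?W = "\<lambda>n x. U n x - V n x"
  have W: "osc_integral c (?W n) = (\<lambda>\<xi>. osc_integral c (U n) \<xi> - osc_integral c (V n) \<xi>)" for n
    by (rule osc_integral_diff[OF U(1) V(1)])
  show ?thesis
    unfolding L2_extends_to_def
  proof (intro conjI exI[of _ ?W] allI)
    show "(\<lambda>n. L2_norm (\<lambda>x. ?W n x - (u x - v x))) \<longlonglongrightarrow> 0"
      by (rule L2_norm_tendsto_diff) (use U V L2 in auto)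
    show "(\<lambda>n. L2_norm (\<lambda>\<xi>. osc_integral c (?W n) \<xi> - (g \<xi> - h \<xi>))) \<longlonglongrightarrow> 0"
      unfolding W by (rule L2_norm_tendsto_diff) (use U V L2 in auto)
  qed (use U V L2 in \<open>auto simp: W intro: L2_diff\<close>)
qed

lemma L2_extends_contraction:
  assumes c: "\<bar>c\<bar> = 2 * pi" and ext: "L2_extends_to (osc_integral c) u g"
  shows "L2_norm g \<le> L2_norm u"
proof -
  obtain U where U: "\<And>n::nat. integrable lebesgue (U n)" "\<And>n. U n \<in> L2" "\<And>n. osc_integral c (U n) \<in> L2"
    "(\<lambda>n. L2_norm (\<lambda>x. U n x - u x)) \<longlonglongrightarrow> 0" "(\<lambda>n. L2_norm (\<lambda>\<xi>. osc_integral c (U n) \<xi> - g \<xi>)) \<longlonglongrightarrow> 0"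
    using ext by (auto simp: L2_extends_to_def)
  note L2 = L2_extends_in_L2[OF ext]
  show ?thesis
    by (rule LIMSEQ_le[OF L2_norm_tendsto[OF U(3) L2(2) U(5)] L2_norm_tendsto[OF U(2) L2(1) U(4)]])
      (use osc_integral_L2[OF c U(1,2)] in auto)
qed

text \<open>
  Values of the extension are determined by the almost everywhere class of the argument, and only
  up to null sets.
\<close>

lemma L2_extends_unique:
  assumes c: "\<bar>c\<bar> = 2 * pi"
    and ext: "L2_extends_to (osc_integral c) u g" "L2_extends_to (osc_integral c) v h"
    and eq: "AE x in lebesgue. u x = v x"
  shows "AE x in lebesgue. g x = h x"
proof -
  note L2 = L2_extends_in_L2[OF ext(1)] L2_extends_in_L2[OF ext(2)]
  have "L2_norm (\<lambda>x. u x - v x) = 0"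
    using eq by (subst L2_norm_eq_0_iff) (auto intro: L2_diff L2)
  then have "L2_norm (\<lambda>x. g x - h x) \<le> 0"
    using L2_extends_contraction[OF c L2_extends_diff[OF ext]] by simp
  then have "L2_norm (\<lambda>x. g x - h x) = 0"
    by (rule order_antisym) simp
  then show ?thesis
    by (subst (asm) L2_norm_eq_0_iff) (auto intro: L2_diff L2)
qed

lemma L2_extends_exists:
  fixes u :: "real ^ 'n \<Rightarrow> complex"
  assumes c: "\<bar>c\<bar> = 2 * pi" and u: "u \<in> L2"
  obtains g where "L2_extends_to (osc_integral c) u g"
proof -
  obtain U where U: "\<And>n::nat. integrable lebesgue (U n)" "\<And>n. U n \<in> L2"
    "(\<lambda>n. L2_norm (\<lambda>x. U n x - u x)) \<longlonglongrightarrow> 0"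
    using L2_truncation[OF u] by blast
  note K = osc_integral_L2(1)[OF c U(1,2)]
  have "\<exists>M. \<forall>i\<ge>M. \<forall>j\<ge>M. L2_norm (\<lambda>x. osc_integral c (U i) x - osc_integral c (U j) x) < e" if e: "0 < e" for e
  proof -
    obtain M where M: "\<And>n. M \<le> n \<Longrightarrow> L2_norm (\<lambda>x. U n x - u x) < e / 2"
      using LIMSEQ_D[OF U(3), of "e / 2"] e by auto
    have "L2_norm (\<lambda>x. osc_integral c (U i) x - osc_integral c (U j) x) < e" if ij: "M \<le> i" "M \<le> j" for i j
    proof -
      have "L2_norm (\<lambda>x. osc_integral c (U i) x - osc_integral c (U j) x) \<le> L2_norm (\<lambda>x. U i x - U j x)"
        unfolding osc_integral_diff[OF U(1,1), symmetric]
        using U by (intro osc_integral_L2(2)[OF c] L2_diff) auto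
      also have "\<dots> \<le> L2_norm (\<lambda>x. U i x - u x) + L2_norm (\<lambda>x. u x - U j x)"
        by (intro L2_norm_triangle_mid U u)
      also have "\<dots> < e"
        using M[OF ij(1)] M[OF ij(2)] L2_norm_minus_commute[of u "U j"] by linarith
      finally show ?thesis .
    qed
    then show ?thesis by blast
  qed
  then obtain g where "g \<in> L2" "(\<lambda>n. L2_norm (\<lambda>x. osc_integral c (U n) x - g x)) \<longlonglongrightarrow> 0"
    using L2_complete[of "\<lambda>n. osc_integral c (U n)"] K by blast
  then have "L2_extends_to (osc_integral c) u g"
    unfolding L2_extends_to_def using U u K by blast
  then show thesis ..
qed

lemma L2_extends_adjoint:
  assumes u: "L2_extends_to (osc_integral c) u g" and v: "L2_extends_to (osc_integral (- c)) v h"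
  shows "L2_inner g v = L2_inner u h"
proof -
  obtain U where U: "\<And>n::nat. integrable lebesgue (U n)" "\<And>n. U n \<in> L2" "\<And>n. osc_integral c (U n) \<in> L2"
    "(\<lambda>n. L2_norm (\<lambda>x. U n x - u x)) \<longlonglongrightarrow> 0" "(\<lambda>n. L2_norm (\<lambda>\<xi>. osc_integral c (U n) \<xi> - g \<xi>)) \<longlonglongrightarrow> 0"
    using u by (auto simp: L2_extends_to_def)
  obtain V where V: "\<And>n::nat. integrable lebesgue (V n)" "\<And>n. V n \<in> L2" "\<And>n. osc_integral (- c) (V n) \<in> L2"
    "(\<lambda>n. L2_norm (\<lambda>x. V n x - v x)) \<longlonglongrightarrow> 0" "(\<lambda>n. L2_norm (\<lambda>\<xi>. osc_integral (- c) (V n) \<xi> - h \<xi>)) \<longlonglongrightarrow> 0"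
    using v by (auto simp: L2_extends_to_def)
  note L2 = L2_extends_in_L2[OF u] L2_extends_in_L2[OF v]
  have "(\<lambda>n. L2_inner (osc_integral c (U n)) (V n)) \<longlonglongrightarrow> L2_inner g v"
    by (rule L2_inner_tendsto) (use U V L2 in auto)
  moreover have "(\<lambda>n. L2_inner (U n) (osc_integral (- c) (V n))) \<longlonglongrightarrow> L2_inner u h"
    by (rule L2_inner_tendsto) (use U V L2 in auto)
  ultimately show ?thesis
    unfolding osc_integral_adjoint[OF U(1) V(1)] by (rule LIMSEQ_unique)
qed

text \<open>
  Let \<open>F\<close> and \<open>F'\<close> be the extensions for \<open>c\<close> and \<open>- c\<close>. They are contractions adjoint to each other,
  so \<open>\<parallel>F' F u - u\<parallel>\<^sup>2 = \<parallel>F' F u\<parallel>\<^sup>2 - 2 * \<parallel>F u\<parallel>\<^sup>2 + \<parallel>u\<parallel>\<^sup>2\<close>, which is nonpositive as soon as \<open>F\<close> does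
  not decrease the norm of \<open>u\<close>.
\<close>

lemma L2_extends_inverse_of_isometric:
  assumes c: "\<bar>c\<bar> = 2 * pi"
    and u: "L2_extends_to (osc_integral c) u g" and g: "L2_extends_to (osc_integral (- c)) g h"
    and norm: "L2_norm u \<le> L2_norm g"
  shows "AE x in lebesgue. h x = u x"
proof -
  note L2 = L2_extends_in_L2[OF u] L2_extends_in_L2[OF g]
  have "L2_inner h u = L2_inner g g"
    using L2_extends_adjoint[OF g, of u g] u by simp
  then have "(L2_norm (\<lambda>x. h x - u x))\<^sup>2 = (L2_norm h)\<^sup>2 - 2 * (L2_norm g)\<^sup>2 + (L2_norm u)\<^sup>2"
    by (simp add: L2_norm_diff_square L2 Re_L2_inner_self)
  moreover have "(L2_norm h)\<^sup>2 \<le> (L2_norm g)\<^sup>2"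
    using L2_extends_contraction[OF _ g] c by (intro power_mono) auto
  moreover have "(L2_norm u)\<^sup>2 \<le> (L2_norm g)\<^sup>2"
    using norm by (intro power_mono) auto
  ultimately have "(L2_norm (\<lambda>x. h x - u x))\<^sup>2 \<le> 0"
    by linarith
  then have "L2_norm (\<lambda>x. h x - u x) = 0"
    by simp
  then show ?thesis
    by (subst (asm) L2_norm_eq_0_iff) (auto intro: L2_diff L2)
qed

lemma indicator_L2:
  fixes A :: "(real ^ 'n) set"
  assumes A: "A \<in> sets lebesgue" "emeasure lebesgue A < \<infinity>"
  shows "integrable lebesgue (indicator A :: _ \<Rightarrow> complex)"
    and "(indicator A :: _ \<Rightarrow> complex) \<in> L2"
    and "(L2_norm (indicator A))\<^sup>2 = measure lebesgue A"
proof -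
  have sq: "(cmod (indicator A x))\<^sup>2 = indicator A x" for x
    by (simp add: indicator_def)
  have int: "integrable lebesgue (indicator A :: _ \<Rightarrow> real)"
    using A by (intro integrable_real_indicator) auto
  have "(\<lambda>x. complex_of_real (indicator A x)) = indicator A"
    by (auto simp: indicator_def)
  then show "integrable lebesgue (indicator A :: _ \<Rightarrow> complex)"
    using integrable_of_real[OF int, where 'a=complex] by simp
  then show "(indicator A :: _ \<Rightarrow> complex) \<in> L2"
    using int by (simp add: L2_def sq)
  show "(L2_norm (indicator A))\<^sup>2 = measure lebesgue A"
    unfolding L2_norm_square sq using A by simp
qed

lemma L2_extends_isometric_open:
  fixes S :: "(real ^ 'n) set"
  assumes c: "\<bar>c\<bar> = 2 * pi" and S: "open S" "emeasure lebesgue S < \<infinity>"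
    and ext: "L2_extends_to (osc_integral c) (indicator S) g"
  shows "L2_norm (indicator S) \<le> L2_norm g"
proof (rule power2_le_imp_le)
  have [measurable]: "S \<in> sets lebesgue" using S by simp
  note ind = indicator_L2[OF this S(2)]
  let ?k = "osc_integral c (indicator S)"
  have k: "L2_extends_to (osc_integral c) (indicator S) ?k"
    by (rule L2_extends_integrable[OF c ind(1,2)])
  have "AE x in lebesgue. g x = ?k x"
    by (rule L2_extends_unique[OF c ext k]) simp
  then have "L2_norm g = L2_norm ?k"
    using L2_extends_in_L2(2)[OF ext] L2_extends_in_L2(2)[OF k] by (intro L2_norm_cong_AE) (auto dest: L2_measurable)
  moreover have "measure lebesgue S \<le> (L2_norm ?k)\<^sup>2"
  proof -
    have "ennreal (measure lebesgue S) = emeasure lebesgue S"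
      using S(2) by (intro emeasure_eq_ennreal_measure[symmetric]) auto
    also have "\<dots> \<le> (\<integral>\<^sup>+\<xi>. ennreal ((cmod (?k \<xi>))\<^sup>2) \<partial>lborel)"
      by (rule osc_integral_indicator_open_ge[OF c S])
    also have "\<dots> = ennreal ((L2_norm ?k)\<^sup>2)"
      unfolding nn_integral_L2_norm[OF L2_extends_in_L2(2)[OF k], symmetric] by (simp only: nn_integral_completion)
    finally show ?thesis by (rule ennreal_le_iff[THEN iffD1, rotated]) simp
  qed
  ultimately show "(L2_norm (indicator S))\<^sup>2 \<le> (L2_norm g)\<^sup>2"
    by (simp only: ind(3))
qed simp

text \<open>
  Passage from open sets to measurable sets, by outer regularity and contractivity.
\<close>

lemma L2_extends_isometric_measurable:
  fixes A :: "(real ^ 'n) set"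
  assumes c: "\<bar>c\<bar> = 2 * pi" and A: "A \<in> sets lebesgue" "emeasure lebesgue A < \<infinity>"
    and ext: "L2_extends_to (osc_integral c) (indicator A) g"
  shows "L2_norm (indicator A) \<le> L2_norm g"
proof (rule field_le_epsilon)
  fix e :: real assume e: "0 < e"
  obtain T where T: "open T" "A \<subseteq> T" "T - A \<in> lmeasurable" "emeasure lebesgue (T - A) < ennreal (e\<^sup>2)"
    using sets_lebesgue_outer_open[OF A(1), of "e\<^sup>2"] e by auto
  have Tm: "T \<in> sets lebesgue" using T(1) by simp
  have "emeasure lebesgue T = emeasure lebesgue A + emeasure lebesgue (T - A)"
    using A(1) Tm T(2) by (subst plus_emeasure) (auto simp: Un_absorb1)
  then have Tfin: "emeasure lebesgue T < \<infinity>"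
    using A(2) T(4) by (auto simp: less_top[symmetric] top_unique)
  note indA = indicator_L2[OF A] and indT = indicator_L2[OF Tm Tfin]
  obtain t where t: "L2_extends_to (osc_integral c) (indicator T) t"
    using L2_extends_exists[OF c indT(2)] .
  have diff: "(\<lambda>x. indicator T x - indicator A x :: complex) = indicator (T - A)"
    by (rule HOL.ext) (use T(2) in \<open>auto simp: indicator_def\<close>)
  have D: "T - A \<in> sets lebesgue" "emeasure lebesgue (T - A) < \<infinity>"
    using T(3,4) by (auto simp: fmeasurable_def)
  have small: "L2_norm (indicator (T - A)) \<le> e"
  proof (rule power2_le_imp_le)
    have "ennreal (measure lebesgue (T - A)) < ennreal (e\<^sup>2)"
      using T(4) D(2) by (simp add: emeasure_eq_ennreal_measure)
    then show "(L2_norm (indicator (T - A)))\<^sup>2 \<le> e\<^sup>2"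
      unfolding indicator_L2(3)[OF D] by (simp add: ennreal_less_iff)
  qed (use e in simp)
  have "L2_norm (indicator A) \<le> L2_norm (indicator T)"
  proof (rule power2_le_imp_le)
    show "(L2_norm (indicator A))\<^sup>2 \<le> (L2_norm (indicator T))\<^sup>2"
      unfolding indA(3) indT(3)
      using T(2) A Tm Tfin by (intro measure_mono_fmeasurable) (auto simp: fmeasurable_def)
  qed simp
  also have "\<dots> \<le> L2_norm t"
    by (rule L2_extends_isometric_open[OF c T(1) Tfin t])
  also have "\<dots> \<le> L2_norm g + L2_norm (\<lambda>x. t x - g x)"
    using L2_norm_diff_bound[OF L2_extends_in_L2(2)[OF t] L2_extends_in_L2(2)[OF ext]] by linarith
  also have "L2_norm (\<lambda>x. t x - g x) \<le> L2_norm (indicator (T - A))"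
    using L2_extends_contraction[OF c L2_extends_diff[OF t ext]] by (simp only: diff)
  also note small
  finally show "L2_norm (indicator A) \<le> L2_norm g + e" by simp
qed

lemma L2_eq_0_if_orthogonal_indicators:
  fixes d :: "real ^ 'n \<Rightarrow> complex"
  assumes d: "d \<in> L2"
    and orth: "\<And>A. A \<in> sets lebesgue \<Longrightarrow> emeasure lebesgue A < \<infinity> \<Longrightarrow> L2_inner d (indicator A) = 0"
  shows "AE x in lebesgue. d x = 0"
proof -
  \<comment> \<open>\<open>d\<close> need not be integrable, but its restriction to a ball is\<close>
  have "AE x in lebesgue. indicator (cball 0 (real n)) x * d x = 0" for n
  proof (rule lebesgue.density_zero)
    let ?B = "cball 0 (real n) :: (real ^ 'n) set"
    have Bfin: "emeasure lebesgue ?B < \<infinity>"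
      using emeasure_bounded_finite[OF bounded_cball] by auto
    have fin: "emeasure lebesgue (?B \<inter> A) < \<infinity>" for A
      using emeasure_mono[of "?B \<inter> A" ?B lebesgue] Bfin by (auto intro: le_less_trans)
    have ind: "d x * cnj (indicator (?B \<inter> A) x) = indicator A x *\<^sub>R (indicator ?B x * d x)" for A x
      by (auto simp: indicator_def)
    show "integrable lebesgue (\<lambda>x. indicator ?B x * d x)"
    proof -
      have "integrable lebesgue (\<lambda>x. d x * cnj (indicator ?B x))"
        by (rule L2_inner_integrable[OF d indicator_L2(2)]) (use Bfin in auto)
      moreover have "(\<lambda>x. d x * cnj (indicator ?B x)) = (\<lambda>x. indicator ?B x * d x)"
        by (rule HOL.ext) (simp add: indicator_def)
      ultimately show ?thesis by simp
    qed
    show "set_lebesgue_integral lebesgue A (\<lambda>x. indicator ?B x * d x) = 0" if A: "A \<in> sets lebesgue" for A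
    proof -
      have "?B \<inter> A \<in> sets lebesgue" using A by auto
      from orth[OF this fin] show ?thesis
        unfolding set_lebesgue_integral_def L2_inner_def ind .
    qed
  qed
  then have "AE x in lebesgue. \<forall>n. indicator (cball 0 (real n)) x * d x = 0"
    by (rule AE_all_countable[THEN iffD2, OF allI])
  then show ?thesis
  proof eventually_elim
    case (elim x)
    have "x \<in> cball 0 (real (nat \<lceil>norm x\<rceil>))" by (simp add: of_nat_ceiling)
    then show ?case using elim[rule_format, of "nat \<lceil>norm x\<rceil>"] by simp
  qed
qed

text \<open>
  Fourier inversion. The operator \<open>F' F\<close> is self-adjoint and fixes the indicator functions of all
  sets of finite measure, so \<open>F' F u - u\<close> is orthogonal to all of them.
\<close>

theorem L2_extends_inverse:
  fixes u :: "real ^ 'n \<Rightarrow> complex"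
  assumes c: "\<bar>c\<bar> = 2 * pi"
    and u: "L2_extends_to (osc_integral c) u g" and g: "L2_extends_to (osc_integral (- c)) g h"
  shows "AE x in lebesgue. h x = u x"
proof -
  note L2 = L2_extends_in_L2[OF u] L2_extends_in_L2[OF g]
  have c': "\<bar>- c\<bar> = 2 * pi" using c by simp
  have "AE x in lebesgue. h x - u x = 0"
  proof (rule L2_eq_0_if_orthogonal_indicators)
    fix A :: "(real ^ 'n) set" assume A: "A \<in> sets lebesgue" "emeasure lebesgue A < \<infinity>"
    note ind = indicator_L2[OF A]
    obtain a where a: "L2_extends_to (osc_integral c) (indicator A) a"
      using L2_extends_exists[OF c ind(2)] .
    obtain b where b: "L2_extends_to (osc_integral (- c)) a b"
      using L2_extends_exists[OF c' L2_extends_in_L2(2)[OF a]] .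
    have eq: "AE x in lebesgue. b x = indicator A x"
      by (rule L2_extends_inverse_of_isometric[OF c a b L2_extends_isometric_measurable[OF c A a]])
    have "L2_inner h (indicator A) = L2_inner g a"
      using L2_extends_adjoint[OF g, of "indicator A" a] a by simp
    also have "\<dots> = L2_inner u b"
      by (rule L2_extends_adjoint[OF u b])
    also have "\<dots> = L2_inner u (indicator A)"
      unfolding L2_inner_def
      using L2_inner_integrable[OF L2(1) L2_extends_in_L2(2)[OF b]] L2_inner_integrable[OF L2(1) ind(2)] eq
      by (intro integral_cong_AE) (auto elim!: eventually_mono)
    finally show "L2_inner (\<lambda>x. h x - u x) (indicator A) = 0"
      by (simp add: L2_inner_diff_left L2 ind)
  qed (intro L2_diff L2)
  then show ?thesis by simp
qed

theorem L2_extends_plancherel: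
  assumes c: "\<bar>c\<bar> = 2 * pi" and u: "L2_extends_to (osc_integral c) u g"
  shows "L2_norm g = L2_norm u"
proof (rule order_antisym)
  show "L2_norm g \<le> L2_norm u" by (rule L2_extends_contraction[OF c u])
  have c': "\<bar>- c\<bar> = 2 * pi" using c by simp
  obtain h where h: "L2_extends_to (osc_integral (- c)) g h"
    using L2_extends_exists[OF c' L2_extends_in_L2(2)[OF u]] .
  have "L2_norm u = L2_norm h"
    using L2_extends_inverse[OF c u h] L2_extends_in_L2[OF u] L2_extends_in_L2[OF h]
    by (intro L2_norm_cong_AE) (auto dest: L2_measurable)
  also have "\<dots> \<le> L2_norm g"
    by (rule L2_extends_contraction[OF c' h])
  finally show "L2_norm u \<le> L2_norm g" .
qed

section \<open>The Sobolev space and the adjoint of its embedding\<close>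

lemma fourier_extends:
  assumes "u \<in> L2"
  shows "L2_extends_to (osc_integral (- (2 * pi))) u (fourier u)"
proof -
  obtain g where "L2_extends_to (osc_integral (- (2 * pi))) u g"
    using L2_extends_exists[of "- (2 * pi)" u] assms by auto
  then show ?thesis
    unfolding fourier_def L2_extension_def fourier_integral_eq_osc_integral by (rule someI[of "L2_extends_to (osc_integral (- (2 * pi))) u"])
qed

lemma inv_fourier_extends:
  assumes "u \<in> L2"
  shows "L2_extends_to (osc_integral (2 * pi)) u (inv_fourier u)"
proof -
  obtain g where "L2_extends_to (osc_integral (2 * pi)) u g"
    using L2_extends_exists[of "2 * pi" u] assms by auto
  then show ?thesis
    unfolding inv_fourier_def L2_extension_def inv_fourier_integral_eq_osc_integral by (rule someI[of "L2_extends_to (osc_integral (2 * pi)) u"])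
qed

lemma fourier_L2: "u \<in> L2 \<Longrightarrow> fourier u \<in> L2"
  by (rule L2_extends_in_L2(2)[OF fourier_extends])

lemma inv_fourier_L2: "u \<in> L2 \<Longrightarrow> inv_fourier u \<in> L2"
  by (rule L2_extends_in_L2(2)[OF inv_fourier_extends])

lemma fourier_inv_fourier:
  assumes "g \<in> L2"
  shows "AE \<xi> in lebesgue. fourier (inv_fourier g) \<xi> = g \<xi>"
  by (rule L2_extends_inverse[of "2 * pi" g "inv_fourier g"])
    (use assms inv_fourier_extends fourier_extends[OF inv_fourier_L2] in auto)

lemma inv_fourier_fourier:
  assumes "u \<in> L2"
  shows "AE x in lebesgue. inv_fourier (fourier u) x = u x"
  by (rule L2_extends_inverse[of "- (2 * pi)" u "fourier u"])
    (use assms fourier_extends inv_fourier_extends[OF fourier_L2] in auto)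

lemma fourier_diff:
  assumes "u \<in> L2" "v \<in> L2"
  shows "AE \<xi> in lebesgue. fourier (\<lambda>x. u x - v x) \<xi> = fourier u \<xi> - fourier v \<xi>"
  by (rule L2_extends_unique[OF _ fourier_extends L2_extends_diff[OF fourier_extends fourier_extends]])
    (use assms in \<open>auto intro: L2_diff\<close>)

lemma L2_norm_fourier: "u \<in> L2 \<Longrightarrow> L2_norm (fourier u) = L2_norm u"
  by (rule L2_extends_plancherel[OF _ fourier_extends]) simp_all

lemma L2_inner_fourier:
  assumes u: "u \<in> L2" and v: "v \<in> L2"
  shows "L2_inner (fourier u) (fourier v) = L2_inner u v"
proof -
  have "L2_inner (fourier u) (fourier v) = L2_inner u (inv_fourier (fourier v))"
    using L2_extends_adjoint[OF fourier_extends[OF u]] inv_fourier_extends[OF fourier_L2[OF v]] by simp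
  also have "\<dots> = L2_inner u v"
    unfolding L2_inner_def
    using L2_inner_integrable[OF u inv_fourier_L2[OF fourier_L2[OF v]]] L2_inner_integrable[OF u v]
      inv_fourier_fourier[OF v]
    by (intro integral_cong_AE) (auto elim!: eventually_mono)
  finally show ?thesis .
qed

text \<open>
  The symbol whose product with the Fourier transform has to lie in \<open>L2\<close> for membership in the
  Sobolev space.
\<close>

definition bessel_symbol :: "real \<Rightarrow> real ^ 'n \<Rightarrow> real" where
  "bessel_symbol s \<xi> = (1 + 4 * pi\<^sup>2 * (norm \<xi>)\<^sup>2) powr (s / 2)"

lemma bessel_symbol_measurable [measurable]: "bessel_symbol s \<in> borel_measurable borel"
  unfolding bessel_symbol_def by measurable

lemma sobolev_weight_measurable [measurable]: "sobolev_weight s \<in> borel_measurable borel"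
  unfolding sobolev_weight_def by measurable

lemma sobolev_weight_ge_1: "1 \<le> sobolev_weight s \<xi>"
  by (simp add: sobolev_weight_def)

lemma bessel_symbol_ge_1: "0 \<le> s \<Longrightarrow> 1 \<le> bessel_symbol s \<xi>"
  unfolding bessel_symbol_def by (rule ge_one_powr_ge_zero) auto

lemma bessel_symbol_square: "(bessel_symbol s \<xi>)\<^sup>2 = (1 + (2 * pi * norm \<xi>)\<^sup>2) powr s"
proof -
  have "1 + 4 * pi\<^sup>2 * (norm \<xi>)\<^sup>2 = 1 + (2 * pi * norm \<xi>)\<^sup>2"
    by (simp add: power_mult_distrib)
  moreover have "(x powr (s / 2))\<^sup>2 = x powr s" for x :: real
    by (simp add: power2_eq_square flip: powr_add)
  ultimately show ?thesis
    by (simp only: bessel_symbol_def)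
qed

lemma powr_double: "0 \<le> t \<Longrightarrow> (t::real) powr (2 * s) = (t\<^sup>2) powr s"
  by (cases "t = 0") (simp_all flip: powr_powr)

text \<open>
  The weight of the inner product and the square of the symbol defining the space are comparable.
  This estimate makes the inner product absolutely convergent on the Sobolev space; the next one
  places the candidate for the adjoint in the space.
\<close>

lemma sobolev_weight_le:
  assumes s: "0 \<le> s"
  shows "sobolev_weight s \<xi> \<le> 2 * (bessel_symbol s \<xi>)\<^sup>2"
proof -
  let ?t = "2 * pi * norm \<xi>"
  have "?t powr (2 * s) \<le> (1 + ?t\<^sup>2) powr s"
    using s by (subst powr_double) (auto intro!: powr_mono2)
  moreover have "1 \<le> (1 + ?t\<^sup>2) powr s"
    using s by (intro ge_one_powr_ge_zero) auto
  ultimately show ?thesis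
    unfolding bessel_symbol_square sobolev_weight_def by linarith
qed

lemma bessel_symbol_le:
  assumes s: "0 \<le> s"
  shows "bessel_symbol s \<xi> \<le> 2 powr s * sobolev_weight s \<xi>"
proof -
  let ?t = "2 * pi * norm \<xi>"
  have "bessel_symbol s \<xi> \<le> (bessel_symbol s \<xi>)\<^sup>2"
    using bessel_symbol_ge_1[OF s, of \<xi>] by (intro self_le_power) auto
  also have "\<dots> \<le> (2 * max 1 (?t\<^sup>2)) powr s"
    unfolding bessel_symbol_square using s by (intro powr_mono2) auto
  also have "\<dots> = 2 powr s * max 1 (?t\<^sup>2) powr s"
    by (simp add: powr_mult)
  also have "max 1 (?t\<^sup>2) powr s \<le> sobolev_weight s \<xi>"
    unfolding sobolev_weight_def by (subst powr_double) (auto simp: max_def)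
  finally show ?thesis by simp
qed

text \<open>
  The condition on \<open>inv_fourier\<close> in \<open>sobolev\<close> holds automatically, as \<open>inv_fourier\<close> maps \<open>L2\<close> to
  itself.
\<close>

lemma sobolev_iff:
  "u \<in> sobolev s \<longleftrightarrow> u \<in> L2 \<and> (\<lambda>\<xi>. complex_of_real (bessel_symbol s \<xi>) * fourier u \<xi>) \<in> L2"
  unfolding sobolev_def bessel_symbol_def by (auto intro: inv_fourier_L2)

lemma borel_measurable_lebesgueI:
  "f \<in> borel_measurable borel \<Longrightarrow> f \<in> borel_measurable lebesgue"
  by (rule measurable_completion) simp

lemma integrable_sobolev_inner:
  assumes s: "0 \<le> s" and u: "u \<in> sobolev s" and v: "v \<in> sobolev s"
  shows "integrable lebesgue
    (\<lambda>\<xi>. complex_of_real (sobolev_weight s \<xi>) * fourier u \<xi> * cnj (fourier v \<xi>))"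
proof (rule Bochner_Integration.integrable_bound)
  let ?b = "\<lambda>u \<xi>. complex_of_real (bessel_symbol s \<xi>) * fourier u \<xi>"
  have [measurable]: "fourier u \<in> borel_measurable lebesgue" "fourier v \<in> borel_measurable lebesgue"
    using u v by (auto simp: sobolev_iff intro: fourier_L2 L2_measurable)
  have [measurable]: "sobolev_weight s \<in> borel_measurable lebesgue"
    by (rule borel_measurable_lebesgueI) measurable
  show "integrable lebesgue (\<lambda>\<xi>. 2 * (?b u \<xi> * cnj (?b v \<xi>)))"
    using L2_inner_integrable[of "?b u" "?b v"] u v by (auto simp: sobolev_iff)
  show "(\<lambda>\<xi>. complex_of_real (sobolev_weight s \<xi>) * fourier u \<xi> * cnj (fourier v \<xi>)) \<in> borel_measurable lebesgue"
    by measurable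
  show "AE \<xi> in lebesgue. cmod (complex_of_real (sobolev_weight s \<xi>) * fourier u \<xi> * cnj (fourier v \<xi>))
      \<le> cmod (2 * (?b u \<xi> * cnj (?b v \<xi>)))"
  proof (rule AE_I2)
    fix \<xi>
    have "sobolev_weight s \<xi> * (cmod (fourier u \<xi>) * cmod (fourier v \<xi>)) \<le>
        2 * (bessel_symbol s \<xi>)\<^sup>2 * (cmod (fourier u \<xi>) * cmod (fourier v \<xi>))"
      by (intro mult_right_mono sobolev_weight_le s) auto
    then show "cmod (complex_of_real (sobolev_weight s \<xi>) * fourier u \<xi> * cnj (fourier v \<xi>))
      \<le> cmod (2 * (?b u \<xi> * cnj (?b v \<xi>)))"
      using sobolev_weight_ge_1[of s \<xi>] by (simp add: norm_mult power2_eq_square mult_ac)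
  qed
qed

lemma sobolev_diff:
  assumes u: "u \<in> sobolev s" and v: "v \<in> sobolev s"
  shows "(\<lambda>x. u x - v x) \<in> sobolev s"
proof -
  let ?b = "\<lambda>\<xi>. complex_of_real (bessel_symbol s \<xi>)"
  have L2: "u \<in> L2" "v \<in> L2" and b: "(\<lambda>\<xi>. ?b \<xi> * fourier u \<xi>) \<in> L2" "(\<lambda>\<xi>. ?b \<xi> * fourier v \<xi>) \<in> L2"
    using u v by (auto simp: sobolev_iff)
  let ?d = "\<lambda>x. u x - v x"
  have d: "?d \<in> L2" by (rule L2_diff[OF L2])
  have [measurable]: "fourier ?d \<in> borel_measurable lebesgue"
    by (rule L2_measurable[OF fourier_L2[OF d]])
  have [measurable]: "bessel_symbol s \<in> borel_measurable lebesgue"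
    by (rule borel_measurable_lebesgueI) measurable
  have "(\<lambda>\<xi>. ?b \<xi> * fourier ?d \<xi>) \<in> L2"
  proof (rule L2_cong_AE[OF L2_diff[OF b]])
    show "AE \<xi> in lebesgue. ?b \<xi> * fourier u \<xi> - ?b \<xi> * fourier v \<xi> = ?b \<xi> * fourier ?d \<xi>"
      using fourier_diff[OF L2] by eventually_elim (simp add: right_diff_distrib)
  qed measurable
  with d show ?thesis by (simp add: sobolev_iff)
qed

lemma sobolev_inner_diff_left:
  assumes s: "0 \<le> s" and u: "u \<in> sobolev s" and v: "v \<in> sobolev s" and w: "w \<in> sobolev s"
  shows "sobolev_inner s (\<lambda>x. u x - v x) w = sobolev_inner s u w - sobolev_inner s v w"
proof -
  have L2: "u \<in> L2" "v \<in> L2" using u v by (auto simp: sobolev_iff)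
  note int = integrable_sobolev_inner[OF s]
  let ?f = "\<lambda>u \<xi>. complex_of_real (sobolev_weight s \<xi>) * fourier u \<xi> * cnj (fourier w \<xi>)"
  have "sobolev_inner s (\<lambda>x. u x - v x) w = (LINT \<xi>|lebesgue. ?f u \<xi> - ?f v \<xi>)"
    unfolding sobolev_inner_def
  proof (rule integral_cong_AE)
    show "?f (\<lambda>x. u x - v x) \<in> borel_measurable lebesgue"
      by (rule borel_measurable_integrable[OF int[OF sobolev_diff[OF u v] w]])
    show "(\<lambda>\<xi>. ?f u \<xi> - ?f v \<xi>) \<in> borel_measurable lebesgue"
      by (intro borel_measurable_integrable Bochner_Integration.integrable_diff int u v w)
    show "AE \<xi> in lebesgue. ?f (\<lambda>x. u x - v x) \<xi> = ?f u \<xi> - ?f v \<xi>"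
      using fourier_diff[OF L2] by eventually_elim (simp add: left_diff_distrib right_diff_distrib)
  qed
  also have "\<dots> = sobolev_inner s u w - sobolev_inner s v w"
    unfolding sobolev_inner_def by (intro Bochner_Integration.integral_diff int u v w)
  finally show ?thesis .
qed

lemma sobolev_inner_definite:
  assumes s: "0 \<le> s" and u: "u \<in> sobolev s" and zero: "sobolev_inner s u u = 0"
  shows "AE x in lebesgue. u x = 0"
proof -
  have uL2: "u \<in> L2" using u by (simp add: sobolev_iff)
  let ?f = "\<lambda>\<xi>. sobolev_weight s \<xi> * (cmod (fourier u \<xi>))\<^sup>2"
  have eq: "complex_of_real (sobolev_weight s \<xi>) * fourier u \<xi> * cnj (fourier u \<xi>) =
      complex_of_real (?f \<xi>)" for \<xi>
    by (simp add: complex_norm_square mult.assoc del: of_real_power)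
  have int: "integrable lebesgue ?f"
    using integrable_sobolev_inner[OF s u u] unfolding eq complex_of_real_integrable_eq .
  have nonneg: "0 \<le> ?f \<xi>" for \<xi>
    using sobolev_weight_ge_1[of s \<xi>] by simp
  have "(LINT \<xi>|lebesgue. ?f \<xi>) = 0"
    using zero unfolding sobolev_inner_def eq integral_complex_of_real by simp
  then have "AE \<xi> in lebesgue. ?f \<xi> = 0"
    using integral_nonneg_eq_0_iff_AE[OF int] nonneg by simp
  then have "AE \<xi> in lebesgue. fourier u \<xi> = 0"
  proof eventually_elim
    case (elim \<xi>)
    then show ?case using sobolev_weight_ge_1[of s \<xi>] by auto
  qed
  then have "L2_norm (fourier u) = 0"
    by (subst L2_norm_eq_0_iff[OF fourier_L2[OF uL2]])
  then show ?thesis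
    using L2_norm_eq_0_iff[OF uL2] by (simp add: L2_norm_fourier[OF uL2])
qed

lemma embedding_adjoint_unique:
  assumes s: "0 \<le> s" and v: "is_embedding_adjoint s u v" and w: "is_embedding_adjoint s u w"
  shows "AE x in lebesgue. v x = w x"
proof -
  let ?d = "\<lambda>x. v x - w x"
  have vw: "v \<in> sobolev s" "w \<in> sobolev s"
    using v w by (simp_all add: is_embedding_adjoint_def)
  have d: "?d \<in> sobolev s" by (rule sobolev_diff[OF vw])
  have "sobolev_inner s ?d ?d = L2_inner u ?d - L2_inner u ?d"
    using v w d by (simp add: sobolev_inner_diff_left[OF s vw d] is_embedding_adjoint_def)
  then have "AE x in lebesgue. ?d x = 0"
    by (intro sobolev_inner_definite[OF s d]) simp
  then show ?thesis by simp
qed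

text \<open>
  If \<open>F w\<close> is \<open>F u\<close> divided by the weight, the weight cancels in the Sobolev inner product of
  \<open>w\<close> with \<open>v\<close>, and Plancherel's identity turns the result into the inner product of \<open>u\<close> and
  \<open>v\<close> in \<open>L2\<close>.
\<close>

lemma is_embedding_adjoint_inv_fourier:
  fixes u :: "real ^ 'n \<Rightarrow> complex"
  assumes s: "0 \<le> s" and u: "u \<in> L2"
  shows "is_embedding_adjoint s u
    (inv_fourier (\<lambda>\<xi>. inverse (complex_of_real (sobolev_weight s \<xi>)) * fourier u \<xi>))"
proof -
  let ?m = "\<lambda>\<xi>. complex_of_real (sobolev_weight s \<xi>)"
  let ?b = "\<lambda>\<xi>. complex_of_real (bessel_symbol s \<xi>)"
  let ?q = "\<lambda>\<xi>. inverse (?m \<xi>) * fourier u \<xi>"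
  define w where "w = inv_fourier ?q"
  note Fu = fourier_L2[OF u]
  have [measurable]: "fourier u \<in> borel_measurable lebesgue"
    by (rule L2_measurable[OF Fu])
  have [measurable]: "sobolev_weight s \<in> borel_measurable lebesgue" "bessel_symbol s \<in> borel_measurable lebesgue"
    by (rule borel_measurable_lebesgueI, measurable)+
  have pos: "0 < sobolev_weight s \<xi>" for \<xi> :: "real ^ 'n"
    using sobolev_weight_ge_1[of s \<xi>] by simp
  have q: "?q \<in> L2"
  proof (rule L2_bounded[OF Fu, of _ 1])
    show "AE \<xi> in lebesgue. cmod (?q \<xi>) \<le> 1 * cmod (fourier u \<xi>)"
    proof (rule AE_I2)
      fix \<xi> :: "real ^ 'n"
      have "inverse (sobolev_weight s \<xi>) \<le> 1"
        by (rule inverse_le_1_iff[THEN iffD2]) (simp add: sobolev_weight_ge_1)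
      then have "inverse (sobolev_weight s \<xi>) * cmod (fourier u \<xi>) \<le> 1 * cmod (fourier u \<xi>)"
        by (rule mult_right_mono) simp
      then show "cmod (?q \<xi>) \<le> 1 * cmod (fourier u \<xi>)"
        using pos[of \<xi>] by (simp add: norm_mult norm_inverse)
    qed
  qed measurable
  have w: "w \<in> L2" unfolding w_def by (rule inv_fourier_L2[OF q])
  have Fw: "AE \<xi> in lebesgue. fourier w \<xi> = ?q \<xi>"
    unfolding w_def by (rule fourier_inv_fourier[OF q])
  have [measurable]: "fourier w \<in> borel_measurable lebesgue"
    by (rule L2_measurable[OF fourier_L2[OF w]])
  have "(\<lambda>\<xi>. ?b \<xi> * fourier w \<xi>) \<in> L2"
  proof (rule L2_bounded[OF Fu, of _ "2 powr s"])
    show "AE \<xi> in lebesgue. cmod (?b \<xi> * fourier w \<xi>) \<le> 2 powr s * cmod (fourier u \<xi>)"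
      using Fw
    proof eventually_elim
      case (elim \<xi>)
      have "bessel_symbol s \<xi> / sobolev_weight s \<xi> \<le> 2 powr s"
        using bessel_symbol_le[OF s, of \<xi>] pos[of \<xi>] by (simp add: pos_divide_le_eq)
      then have "bessel_symbol s \<xi> / sobolev_weight s \<xi> * cmod (fourier u \<xi>) \<le> 2 powr s * cmod (fourier u \<xi>)"
        by (rule mult_right_mono) simp
      then show ?case
        using bessel_symbol_ge_1[OF s, of \<xi>] pos[of \<xi>]
        by (simp add: elim norm_mult norm_inverse divide_inverse)
    qed
  qed measurable
  then have sob: "w \<in> sobolev s" using w by (simp add: sobolev_iff)
  have "sobolev_inner s w v = L2_inner u v" if v: "v \<in> sobolev s" for v
  proof -
    have vL2: "v \<in> L2" using v by (simp add: sobolev_iff)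
    have "sobolev_inner s w v = L2_inner (fourier u) (fourier v)"
      unfolding sobolev_inner_def L2_inner_def
    proof (rule integral_cong_AE)
      show "(\<lambda>\<xi>. ?m \<xi> * fourier w \<xi> * cnj (fourier v \<xi>)) \<in> borel_measurable lebesgue"
        by (rule borel_measurable_integrable[OF integrable_sobolev_inner[OF s sob v]])
      show "(\<lambda>\<xi>. fourier u \<xi> * cnj (fourier v \<xi>)) \<in> borel_measurable lebesgue"
        by (rule borel_measurable_integrable[OF L2_inner_integrable[OF Fu fourier_L2[OF vL2]]])
      show "AE \<xi> in lebesgue. ?m \<xi> * fourier w \<xi> * cnj (fourier v \<xi>) = fourier u \<xi> * cnj (fourier v \<xi>)"
        using Fw
      proof eventually_elim
        case (elim \<xi>)
        then show ?case using pos[of \<xi>] by simp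
      qed
    qed
    also have "\<dots> = L2_inner u v" by (rule L2_inner_fourier[OF u vL2])
    finally show ?thesis .
  qed
  with sob show ?thesis
    unfolding is_embedding_adjoint_def w_def by simp
qed

theorem proposition4p2:
  fixes s :: real and u :: "real ^ 'n \<Rightarrow> complex"
  assumes "1 \<le> s" and "u \<in> L2"
  shows "is_embedding_adjoint s u (embedding_adjoint s u) \<and>
    (AE x in lebesgue. embedding_adjoint s u x =
      inv_fourier (\<lambda>\<xi>. inverse (complex_of_real (1 + (2 * pi * norm \<xi>) powr (2 * s))) * fourier u \<xi>) x)"
proof -
  have s: "0 \<le> s" using assms(1) by simp
  note adj = is_embedding_adjoint_inv_fourier[OF s assms(2), unfolded sobolev_weight_def]
  have "is_embedding_adjoint s u (embedding_adjoint s u)"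
    unfolding embedding_adjoint_def by (rule someI[of "is_embedding_adjoint s u", OF adj])
  with embedding_adjoint_unique[OF s this adj] show ?thesis
    by blast
qed

end
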